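(* Let $\theta\in\mathbb{C}$ and let $\{\theta_N\}_{N\ge1}$ be complex numbers with $\lim_{N\to\infty}\theta_N=\theta$. Let $i$ and $k$ be positive integers. Suppose $\{f_{j,N}(x_1,\ldots,x_N)\}_{N\ge i}$ for $1\le j\le k-1$ and $\{g_N(x_1,\ldots,x_N)\}_{N\ge i}$ are sequences of formal power series which are symmetric outside of $i$. Assume that for every $1\le j\le k-1$, $\{f_{j,N}\}$ has limiting sequence $f$ outside of $i$ (the same $f$ for all $j$), and that $\{g_N\}$ has limiting sequence $g$ outside of $i$. Then $$\lim_{N\to\infty}\left([1]\prod_{j=1}^{k-1}\mathcal{Q}_i^N(f_{j,N})\,g_N(x_1,\ldots,x_N)\right)=\sum_{\substack{\pi\in NC(k)\\ \pi=B_1\sqcup\cdots\sqcup B_m}}c_{|B_1|}(g)\prod_{l=2}^mc_{|B_l|}(f).$$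
   Context: Partitions: $P$ is the set of integer partitions (including the empty one); $|\nu|,\ell(\nu)$ are size and number of parts; $P(\nu)$ is the number of distinct permutations of the tuple of parts of $\nu$. $M_\nu$ is the monomial symmetric function of $\nu$. $NC(k)$ is the set of noncrossing partitions of $\{1,\ldots,k\}$; blocks $B_1,B_2,\ldots,B_m$ of $\pi$ are ordered by increasing smallest element, so $1\in B_1$. $\mathcal{F}_i^N$ ($1\le i\le N$) is the set of formal power series over $\mathbb{C}$ in $x_1,\ldots,x_N$ that are symmetric in the variables $x_j$, $j\ne i$; for $F\in\mathcal{F}_i^N$, $c_F^{d,\nu}$ is the coefficient of $x_i^dM_\nu(x_j:j\ne i)$ in $F$ ($d\ge0$, $\ell(\nu)\le N-1$). $[1]F$ is the constant term of $F$. A sequence $\{f_N(x_1,\ldots,x_N)\}_{N\ge i}$ is symmetric outside of $i$ if $f_N\in\mathcal{F}_i^N$ for all $N\ge i$ and $\lim_{N\to\infty}c_{f_N}^{d,\nu}$ exists for all $d\ge0$, $\nu\in P$; its limiting sequence outside of $i$ is $\{\lim_{N\to\infty}c_{f_N}^{d,\nu}\}_{d\ge0,\nu\in P}$. Operators, defined on monomials and extended linearly to formal power series: $d_i\bigl(\prod_kx_k^{a_k}\bigr)=x_i^{a_i-1}\prod_{k\ne i}x_k^{a_k}$ if $a_i\ge1$ and $0$ if $a_i=0$; for $i\neq j$, $C_{i,j}\bigl(\prod_kx_k^{a_k}\bigr)=x_i^{a_j-1}\prod_{k\ne i,j}x_k^{a_k}$ if $a_i=0$ and $a_j\ge1$,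 and $0$ otherwise. For $f\in\mathcal{F}_i^N$, $\mathcal{Q}_i^N(f)=\theta_N\sum_{1\le j\le N,\,j\ne i}\frac{d_i-C_{i,j}}{N}+f$ (with $f$ acting by multiplication), an operator $\mathcal{F}_i^N\to\mathcal{F}_i^N$. A product $\prod_{j=1}^{n}\mathcal{T}_j$ of operators means $\mathcal{T}_n\circ\cdots\circ\mathcal{T}_1$. Free cumulants of a sequence $s=\{c^{d,\nu}\}_{d\ge0,\nu\in P}$: $c_k(s)=\theta^{k-1}\sum_{\nu\in P,\,d\ge0,\,|\nu|+d=k-1}(-1)^{\ell(\nu)}P(\nu)c^{d,\nu}$ for $k\ge1$ (convention $0^0=1$). *)

theory Defs
  imports
    Complex_Main
    "HOL-Library.Poly_Mapping"
    "HOL-Library.Disjoint_Sets"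
    "HOL-Library.Multiset"
    "HOL-Combinatorics.Multiset_Permutations"
begin

section \<open>Formal power series in several variables\<close>

text \<open>A monomial \<open>\<Prod>\<^sub>k x\<^sub>k ^ a k\<close> is its finitely supported exponent vector, and a formal power
  series is its coefficient function.  Membership in the series in \<open>x\<^sub>1, \<dots>, x\<^sub>N\<close> is a predicate
  (part of \<open>sym_series\<close> below), because \<open>N\<close> tends to infinity.\<close>

type_synonym monomial = "nat \<Rightarrow>\<^sub>0 nat"
type_synonym series = "monomial \<Rightarrow> complex"

definition series_mult :: "series \<Rightarrow> series \<Rightarrow> series" where
  "series_mult F G = (\<lambda>m. \<Sum>(a, b) | a + b = m. F a * G b)"

definition const_term :: "series \<Rightarrow> complex" where
  "const_term F = F 0"

definition var_power :: "nat \<Rightarrow> nat \<Rightarrow> series" where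
  "var_power i d = (\<lambda>m. if m = Poly_Mapping.single i d then 1 else 0)"

text \<open>\<open>Poly_Mapping.map_key \<sigma> m\<close> is the exponent vector \<open>a \<circ> \<sigma>\<close>, so the second conjunct is
  invariance under all permutations of the variables \<open>x\<^sub>j\<close>, \<open>j \<noteq> i\<close>.\<close>

definition sym_series :: "nat \<Rightarrow> nat \<Rightarrow> series set" where
  "sym_series N i = {F.
     (\<forall>m. \<not> Poly_Mapping.keys m \<subseteq> {1..N} \<longrightarrow> F m = 0) \<and>
     (\<forall>\<sigma> m. \<sigma> permutes ({1..N} - {i}) \<longrightarrow> F (Poly_Mapping.map_key \<sigma> m) = F m)}"


section \<open>Partitions and monomial symmetric functions\<close>

text \<open>A partition is the multiset of its (positive) parts: \<open>|\<nu>| = \<Sum>\<^sub># \<nu>\<close>, \<open>\<ell>(\<nu>) = size \<nu>\<close> and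
  \<open>P(\<nu>) = card (permutations_of_multiset \<nu>)\<close>.\<close>

definition int_partitions :: "nat multiset set" where
  "int_partitions = {\<nu>. 0 \<notin># \<nu>}"

definition exponents :: "monomial \<Rightarrow> nat multiset" where
  "exponents m = image_mset (Poly_Mapping.lookup m) (mset_set (Poly_Mapping.keys m))"

text \<open>\<open>M\<^sub>\<nu>(x\<^sub>j : j \<in> V)\<close>: the sum of all distinct monomials in these variables whose nonzero
  exponents are the parts of \<open>\<nu>\<close>.\<close>

definition monomial_sym :: "nat set \<Rightarrow> nat multiset \<Rightarrow> series" where
  "monomial_sym V \<nu> = (\<lambda>m. if Poly_Mapping.keys m \<subseteq> V \<and> exponents m = \<nu> then 1 else 0)"

text \<open>\<open>F = \<Sum> c d \<nu> x\<^sub>i\<^sup>d M\<^sub>\<nu>(x\<^sub>j : j \<noteq> i)\<close> over \<open>d \<ge> 0\<close> and partitions \<open>\<nu>\<close> with \<open>\<ell>(\<nu>) \<le> N - 1\<close>.  The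
  sum is formal: for each monomial \<open>m\<close> at most one term is nonzero.\<close>

definition sym_expansion ::
  "nat \<Rightarrow> nat \<Rightarrow> series \<Rightarrow> (nat \<Rightarrow> nat multiset \<Rightarrow> complex) \<Rightarrow> bool" where
  "sym_expansion N i F c \<longleftrightarrow> (\<forall>m. F m =
     Sum_any (\<lambda>(d, \<nu>). if \<nu> \<in> int_partitions \<and> size \<nu> \<le> N - 1
       then c d \<nu> * series_mult (var_power i d) (monomial_sym ({1..N} - {i}) \<nu>) m else 0))"

text \<open>The coefficient \<open>c\<^sub>F\<close> of \<open>x\<^sub>i\<^sup>d M\<^sub>\<nu>(x\<^sub>j : j \<noteq> i)\<close> in \<open>F\<close>, meaningful for \<open>F \<in> sym_series N i\<close>,
  \<open>1 \<le> i \<le> N\<close> and \<open>\<ell>(\<nu>) \<le> N - 1\<close>; see \<open>sym_coeff_eq\<close> for its value.\<close>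

definition sym_coeff :: "nat \<Rightarrow> nat \<Rightarrow> series \<Rightarrow> nat \<Rightarrow> nat multiset \<Rightarrow> complex" where
  "sym_coeff N i F d \<nu> = (THE a. \<exists>c. sym_expansion N i F c \<and> a = c d \<nu>)"

definition symmetric_outside :: "nat \<Rightarrow> (nat \<Rightarrow> series) \<Rightarrow> bool" where
  "symmetric_outside i f \<longleftrightarrow>
     (\<forall>N\<ge>i. f N \<in> sym_series N i) \<and>
     (\<forall>d. \<forall>\<nu>\<in>int_partitions. convergent (\<lambda>N. sym_coeff N i (f N) d \<nu>))"

definition has_limiting_sequence ::
  "nat \<Rightarrow> (nat \<Rightarrow> series) \<Rightarrow> (nat \<Rightarrow> nat multiset \<Rightarrow> complex) \<Rightarrow> bool" where
  "has_limiting_sequence i f s \<longleftrightarrow>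
     (\<forall>d. \<forall>\<nu>\<in>int_partitions. (\<lambda>N. sym_coeff N i (f N) d \<nu>) \<longlonglongrightarrow> s d \<nu>)"


section \<open>Operators\<close>

text \<open>Linear extension to formal power series of a map sending each monomial to a monomial or to
  zero (\<open>None\<close>).  It is only used for maps with finite fibres.\<close>

definition linear_ext :: "(monomial \<Rightarrow> monomial option) \<Rightarrow> series \<Rightarrow> series" where
  "linear_ext T F = (\<lambda>m. \<Sum>m' | T m' = Some m. F m')"

definition d_op :: "nat \<Rightarrow> series \<Rightarrow> series" where
  "d_op i = linear_ext (\<lambda>a.
     if Poly_Mapping.lookup a i \<ge> 1
     then Some (Poly_Mapping.update i (Poly_Mapping.lookup a i - 1) a)
     else None)"

definition C_op :: "nat \<Rightarrow> nat \<Rightarrow> series \<Rightarrow> series" where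
  "C_op i j = linear_ext (\<lambda>a.
     if Poly_Mapping.lookup a i = 0 \<and> Poly_Mapping.lookup a j \<ge> 1
     then Some (Poly_Mapping.update i (Poly_Mapping.lookup a j - 1) (Poly_Mapping.update j 0 a))
     else None)"

definition Q_op :: "complex \<Rightarrow> nat \<Rightarrow> nat \<Rightarrow> series \<Rightarrow> series \<Rightarrow> series" where
  "Q_op \<theta>N N i f F = (\<lambda>m.
     \<theta>N * (\<Sum>j\<in>{1..N} - {i}. (d_op i F m - C_op i j F m) / of_nat N) + series_mult f F m)"


section \<open>Noncrossing partitions and free cumulants\<close>

definition noncrossing_partitions :: "nat \<Rightarrow> nat set set set" where
  "noncrossing_partitions k = {\<pi>. partition_on {1..k} \<pi> \<and>
     \<not> (\<exists>A\<in>\<pi>. \<exists>B\<in>\<pi>. A \<noteq> B \<and>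
         (\<exists>a b c d. a < b \<and> b < c \<and> c < d \<and> a \<in> A \<and> c \<in> A \<and> b \<in> B \<and> d \<in> B))}"

text \<open>\<open>block \<pi> l\<close> is \<open>B\<^sub>l\<close> for \<open>1 \<le> l \<le> card \<pi>\<close>, the blocks being ordered by smallest element.\<close>

definition block :: "nat set set \<Rightarrow> nat \<Rightarrow> nat set" where
  "block \<pi> l = sorted_key_list_of_set Min \<pi> ! (l - 1)"

definition free_cumulant ::
  "complex \<Rightarrow> (nat \<Rightarrow> nat multiset \<Rightarrow> complex) \<Rightarrow> nat \<Rightarrow> complex" where
  "free_cumulant \<theta> s k = \<theta> ^ (k - 1) *
     (\<Sum>(d, \<nu>) | \<nu> \<in> int_partitions \<and> \<Sum>\<^sub># \<nu> + d = k - 1.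
        (- 1) ^ size \<nu> * of_nat (card (permutations_of_multiset \<nu>)) * s d \<nu>)"


section \<open>Well-definedness\<close>

lemma monomial_eq_iff:
  "a = b \<longleftrightarrow> (\<forall>x. Poly_Mapping.lookup a x = Poly_Mapping.lookup (b :: monomial) x)"
  by (auto intro: poly_mapping_eqI)

lemma finite_monomial_splits: "finite {(a, b). a + b = (m :: monomial)}"
proof -
  let ?A = "{a. \<exists>b. a + b = m}"
  let ?S = "{f. \<forall>x. (x \<in> Poly_Mapping.keys m \<longrightarrow> f x \<in> {..Max (insert 0 (Poly_Mapping.lookup m ` Poly_Mapping.keys m))})
      \<and> (x \<notin> Poly_Mapping.keys m \<longrightarrow> f x = (0::nat))}"
  have "Poly_Mapping.lookup ` ?A \<subseteq> ?S"
  proof clarify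
    fix a b :: monomial and x
    show "(x \<in> Poly_Mapping.keys (a + b) \<longrightarrow> Poly_Mapping.lookup a x \<in> {..Max (insert 0 (Poly_Mapping.lookup (a + b) ` Poly_Mapping.keys (a + b)))})
      \<and> (x \<notin> Poly_Mapping.keys (a + b) \<longrightarrow> Poly_Mapping.lookup a x = 0)"
    proof (intro conjI impI)
      assume x: "x \<in> Poly_Mapping.keys (a + b)"
      have "Poly_Mapping.lookup a x \<le> Poly_Mapping.lookup (a + b) x"
        by (simp add: lookup_add)
      also have "\<dots> \<le> Max (insert 0 (Poly_Mapping.lookup (a + b) ` Poly_Mapping.keys (a + b)))"
        using x by (intro Max_ge) auto
      finally show "Poly_Mapping.lookup a x \<in> {..Max (insert 0 (Poly_Mapping.lookup (a + b) ` Poly_Mapping.keys (a + b)))}"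
        by simp
    next
      assume "x \<notin> Poly_Mapping.keys (a + b)"
      then show "Poly_Mapping.lookup a x = 0"
        by (simp add: in_keys_iff lookup_add)
    qed
  qed
  moreover have "finite ?S"
    by (rule finite_set_of_finite_funs) auto
  ultimately have "finite (Poly_Mapping.lookup ` ?A)"
    by (rule finite_subset)
  then have "finite ?A"
    by (rule finite_imageD) (auto intro!: inj_onI)
  moreover have "{(a, b). a + b = m} \<subseteq> (\<lambda>a. (a, m - a)) ` ?A"
    by auto
  ultimately show ?thesis
    by (meson finite_imageI finite_subset)
qed

lemma finite_partitions_of_weight:
  "finite {(d, \<nu>). \<nu> \<in> int_partitions \<and> \<Sum>\<^sub># \<nu> + d = n}"
proof -
  have *: "size \<nu> \<le> \<Sum>\<^sub># \<nu>" "set_mset \<nu> \<subseteq> {..\<Sum>\<^sub># \<nu>}" if "0 \<notin># \<nu>" for \<nu> :: "nat multiset"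
    using that by (induction \<nu>) force+
  have "{\<nu>. \<nu> \<in> int_partitions \<and> \<Sum>\<^sub># \<nu> \<le> n}
      \<subseteq> mset ` {xs. set xs \<subseteq> {..n} \<and> length xs \<le> n}"
  proof
    fix \<nu> :: "nat multiset" assume "\<nu> \<in> {\<nu>. \<nu> \<in> int_partitions \<and> \<Sum>\<^sub># \<nu> \<le> n}"
    then have \<nu>: "0 \<notin># \<nu>" "\<Sum>\<^sub># \<nu> \<le> n" by (auto simp: int_partitions_def)
    obtain xs where xs: "mset xs = \<nu>" using ex_mset by blast
    have "length xs \<le> n" using *(1)[OF \<nu>(1)] \<nu>(2) xs by (metis le_trans size_mset)
    moreover have "set xs \<subseteq> {..n}" using *(2)[OF \<nu>(1)] \<nu>(2) xs by force
    ultimately show "\<nu> \<in> mset ` {xs. set xs \<subseteq> {..n} \<and> length xs \<le> n}" using xs by blast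
  qed
  then have "finite {\<nu>. \<nu> \<in> int_partitions \<and> \<Sum>\<^sub># \<nu> \<le> n}"
    by (rule finite_subset) (intro finite_imageI finite_lists_length_le finite_atMost)
  then have "finite ({..n} \<times> {\<nu>. \<nu> \<in> int_partitions \<and> \<Sum>\<^sub># \<nu> \<le> n})" by simp
  then show ?thesis by (rule rev_finite_subset) auto
qed

lemma d_op_eq: "d_op i F m = F (m + Poly_Mapping.single i 1)"
proof -
  have "{a. (if Poly_Mapping.lookup a i \<ge> 1
     then Some (Poly_Mapping.update i (Poly_Mapping.lookup a i - 1) a)
     else None) = Some m} = {m + Poly_Mapping.single i 1}"
    by (auto simp: monomial_eq_iff lookup_update lookup_add lookup_single when_def
        split: if_splits) (metis Suc_pred Suc_le_eq)
  then show ?thesis by (simp add: d_op_def linear_ext_def)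
qed

lemma C_op_eq:
  assumes "i \<noteq> j"
  shows "C_op i j F m = (if Poly_Mapping.lookup m j = 0
    then F (Poly_Mapping.update j (Poly_Mapping.lookup m i + 1) (Poly_Mapping.update i 0 m)) else 0)"
proof -
  have "{a. (if Poly_Mapping.lookup a i = 0 \<and> Poly_Mapping.lookup a j \<ge> 1
     then Some (Poly_Mapping.update i (Poly_Mapping.lookup a j - 1) (Poly_Mapping.update j 0 a))
     else None) = Some m} = (if Poly_Mapping.lookup m j = 0
       then {Poly_Mapping.update j (Poly_Mapping.lookup m i + 1) (Poly_Mapping.update i 0 m)} else {})"
    using assms
    by (auto simp: monomial_eq_iff lookup_update split: if_splits) (metis Suc_pred Suc_le_eq)
  then show ?thesis by (simp add: C_op_def linear_ext_def)
qed

lemma var_power_monomial_sym: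
  assumes "i \<notin> V"
  shows "series_mult (var_power i d) (monomial_sym V \<nu>) m =
    (if Poly_Mapping.lookup m i = d then monomial_sym V \<nu> (Poly_Mapping.update i 0 m) else 0)"
proof -
  let ?S = "{(a, b). a + b = m}"
  let ?u = "Poly_Mapping.update i 0 m"
  let ?f = "\<lambda>(a, b). var_power i d a * monomial_sym V \<nu> b"
  have eq: "Poly_Mapping.single i (Poly_Mapping.lookup m i) + ?u = m"
    by (auto simp: monomial_eq_iff lookup_update lookup_add lookup_single when_def)
  have ne: "p = (Poly_Mapping.single i d, ?u) \<and> Poly_Mapping.lookup m i = d"
    if "p \<in> ?S" "?f p \<noteq> 0" for p
  proof -
    obtain a b where p: "p = (a, b)" by force
    have a: "a = Poly_Mapping.single i d" and b: "Poly_Mapping.keys b \<subseteq> V" and s: "a + b = m"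
      using that by (auto simp: p var_power_def monomial_sym_def split: if_splits)
    have bi: "Poly_Mapping.lookup b i = 0"
      using assms b by (auto simp: in_keys_iff)
    have "b = ?u"
      using bi unfolding s[symmetric] a
      by (auto simp: monomial_eq_iff lookup_update lookup_add lookup_single when_def)
    moreover have "Poly_Mapping.lookup m i = d"
      using bi unfolding s[symmetric] a by (simp add: lookup_add)
    ultimately show ?thesis by (simp add: p a)
  qed
  show ?thesis
  proof (cases "Poly_Mapping.lookup m i = d")
    case True
    have "sum ?f ?S = sum ?f {(Poly_Mapping.single i d, ?u)}"
      using ne eq True by (intro sum.mono_neutral_right finite_monomial_splits) blast+
    then show ?thesis using True by (simp add: series_mult_def var_power_def)
  next
    case False
    have "sum ?f ?S = 0" using ne False by (intro sum.neutral) blast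
    then show ?thesis using False by (simp add: series_mult_def)
  qed
qed

lemma exponents_in_int_partitions: "exponents m \<in> int_partitions"
  by (auto simp: exponents_def int_partitions_def in_keys_iff)

lemma sym_expansion_iff:
  assumes "1 \<le> i" "i \<le> N"
  shows "sym_expansion N i F c \<longleftrightarrow> (\<forall>m. F m =
    (if Poly_Mapping.keys m \<subseteq> {1..N}
     then c (Poly_Mapping.lookup m i) (exponents (Poly_Mapping.update i 0 m)) else 0))"
proof -
  have "Sum_any (\<lambda>(d, \<nu>). if \<nu> \<in> int_partitions \<and> size \<nu> \<le> N - 1
       then c d \<nu> * series_mult (var_power i d) (monomial_sym ({1..N} - {i}) \<nu>) m else 0) =
     (if Poly_Mapping.keys m \<subseteq> {1..N}
     then c (Poly_Mapping.lookup m i) (exponents (Poly_Mapping.update i 0 m)) else 0)"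
    (is "Sum_any ?f = ?r") for m
  proof -
    let ?u = "Poly_Mapping.update i 0 m"
    let ?p = "(Poly_Mapping.lookup m i, exponents ?u)"
    have ku: "Poly_Mapping.keys ?u = Poly_Mapping.keys m - {i}"
      by (auto simp: in_keys_iff lookup_update split: if_splits)
    have k: "Poly_Mapping.keys ?u \<subseteq> {1..N} - {i} \<longleftrightarrow> Poly_Mapping.keys m \<subseteq> {1..N}"
      unfolding ku using assms by auto
    have sz: "size (exponents ?u) \<le> N - 1" if "Poly_Mapping.keys m \<subseteq> {1..N}"
    proof -
      have "card (Poly_Mapping.keys ?u) \<le> card ({1..N} - {i})"
        using k that by (intro card_mono) auto
      then show ?thesis using assms by (simp add: exponents_def)
    qed
    have ms: "series_mult (var_power i d) (monomial_sym ({1..N} - {i}) \<nu>) m =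
        (if Poly_Mapping.lookup m i = d \<and> Poly_Mapping.keys m \<subseteq> {1..N} \<and> exponents ?u = \<nu>
         then 1 else 0)" for d \<nu>
      using var_power_monomial_sym[of i "{1..N} - {i}" d \<nu> m]
      unfolding monomial_sym_def k by auto
    have "?f = (\<lambda>p. ?r when p = ?p)"
    proof
      fix p :: "nat \<times> nat multiset"
      obtain d \<nu> where p: "p = (d, \<nu>)" by force
      show "?f p = (?r when p = ?p)"
      proof (cases "p = ?p \<and> Poly_Mapping.keys m \<subseteq> {1..N}")
        case True
        then have "series_mult (var_power i d) (monomial_sym ({1..N} - {i}) \<nu>) m = 1"
          unfolding ms using p by simp
        moreover have "\<nu> \<in> int_partitions \<and> size \<nu> \<le> N - 1"
          using True sz exponents_in_int_partitions[of ?u] p by blast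
        ultimately have "?f p = c d \<nu>" unfolding p prod.case by (metis mult.right_neutral)
        then show ?thesis using True p by simp
      next
        case False
        then have "series_mult (var_power i d) (monomial_sym ({1..N} - {i}) \<nu>) m = 0"
          unfolding ms using p by auto
        then have "?f p = 0" unfolding p prod.case by (metis mult_zero_right)
        moreover have "(?r when p = ?p) = 0"
          using False unfolding when_def by presburger
        ultimately show ?thesis by (rule trans[OF _ sym])
      qed
    qed
    then show ?thesis by (simp only: Sum_any_when_equal)
  qed
  then show ?thesis by (simp only: sym_expansion_def)
qed

lemma sym_series_exponents_cong:
  assumes F: "F \<in> sym_series N i"
    and m: "Poly_Mapping.keys m \<subseteq> {1..N}" "Poly_Mapping.keys m' \<subseteq> {1..N}"
    and i: "Poly_Mapping.lookup m i = Poly_Mapping.lookup m' i"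
    and e: "exponents (Poly_Mapping.update i 0 m) = exponents (Poly_Mapping.update i 0 m')"
  shows "F m = F m'"
proof -
  let ?A = "{1..N} - {i}"
  have ext: "image_mset (Poly_Mapping.lookup m) (mset_set ?A) =
      exponents (Poly_Mapping.update i 0 m) +
      replicate_mset (card ?A - size (exponents (Poly_Mapping.update i 0 m))) 0"
    if "Poly_Mapping.keys m \<subseteq> {1..N}" for m
  proof -
    let ?K = "Poly_Mapping.keys m - {i}"
    have ku: "Poly_Mapping.keys (Poly_Mapping.update i 0 m) = ?K"
      by (auto simp: in_keys_iff lookup_update split: if_splits)
    have fin: "finite ?K" by simp
    have K: "?K \<subseteq> ?A" using that by auto
    have ex: "exponents (Poly_Mapping.update i 0 m) = image_mset (Poly_Mapping.lookup m) (mset_set ?K)"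
      unfolding exponents_def ku by (intro image_mset_cong) (auto simp: lookup_update)
    have "mset_set ?A = mset_set ?K + mset_set (?A - ?K)"
      using K fin by (metis Diff_disjoint Diff_partition finite_Diff finite_atLeastAtMost mset_set_Union)
    moreover have "image_mset (Poly_Mapping.lookup m) (mset_set (?A - ?K)) =
        image_mset (\<lambda>_. 0) (mset_set (?A - ?K))"
      by (intro image_mset_cong) (auto simp: in_keys_iff)
    moreover have "card (?A - ?K) = card ?A - size (exponents (Poly_Mapping.update i 0 m))"
      using K fin by (simp add: ex card_Diff_subset del: Diff_iff)
    ultimately show ?thesis by (simp add: ex image_mset_const_eq)
  qed
  have "image_mset (Poly_Mapping.lookup m) (mset_set ?A) =
        image_mset (Poly_Mapping.lookup m') (mset_set ?A)"
    unfolding ext[OF m(1)] ext[OF m(2)] e ..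
  then obtain p where p: "p permutes ?A"
      and pm: "\<forall>x\<in>?A. Poly_Mapping.lookup m x = Poly_Mapping.lookup m' (p x)"
    using image_mset_eq_implies_permutes[of ?A] by (metis finite_Diff finite_atLeastAtMost)
  have "Poly_Mapping.lookup m x = Poly_Mapping.lookup m' (p x)" for x
  proof (cases "x \<in> ?A")
    case False
    then have "p x = x" using p by (simp add: permutes_not_in)
    moreover have "Poly_Mapping.lookup m x = Poly_Mapping.lookup m' x"
    proof (cases "x = i")
      case False
      with \<open>x \<notin> ?A\<close> have "x \<notin> {1..N}" by simp
      with m have "x \<notin> Poly_Mapping.keys m" "x \<notin> Poly_Mapping.keys m'" by blast+
      then show ?thesis by (simp add: in_keys_iff)
    qed (simp add: i)
    ultimately show ?thesis by simp
  qed (use pm in simp)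
  then have "Poly_Mapping.map_key p m' = m"
    using permutes_inj[OF p] by (simp add: monomial_eq_iff map_key.rep_eq)
  then show ?thesis using F p unfolding sym_series_def by blast
qed

lemma ex_monomial_with_exponents:
  assumes "1 \<le> i" "i \<le> N" "\<nu> \<in> int_partitions" "size \<nu> \<le> N - 1"
  shows "\<exists>m. Poly_Mapping.keys m \<subseteq> {1..N} \<and> Poly_Mapping.lookup m i = d \<and>
    exponents (Poly_Mapping.update i 0 m) = \<nu>"
proof -
  obtain xs where xs: "mset xs = \<nu>" using ex_mset by blast
  have "card {..<length xs} \<le> card ({1..N} - {i})"
    using assms xs by (auto simp flip: size_mset)
  then obtain g where g: "g ` {..<length xs} \<subseteq> {1..N} - {i}" "inj_on g {..<length xs}"
    using card_le_inj[of "{..<length xs}" "{1..N} - {i}"] by auto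
  define f where "f x = (if x = i then d else if x \<in> g ` {..<length xs}
    then xs ! (the_inv_into {..<length xs} g x) else 0)" for x
  have fin: "finite {x. f x \<noteq> 0}"
    by (rule finite_subset[of _ "insert i (g ` {..<length xs})"]) (auto simp: f_def)
  define m where "m = Abs_poly_mapping f"
  have lm: "Poly_Mapping.lookup m = f"
    using fin by (simp add: m_def Abs_poly_mapping_inverse)
  have pos: "xs ! n \<noteq> 0" if "n < length xs" for n
    using assms(3) xs that by (metis int_partitions_def mem_Collect_eq nth_mem_mset)
  have fg: "f (g n) = xs ! n" if "n < length xs" for n
    using g that by (auto simp: f_def the_inv_into_f_f)
  have ku: "Poly_Mapping.keys (Poly_Mapping.update i 0 m) = g ` {..<length xs}"
  proof -
    have "x \<in> Poly_Mapping.keys (Poly_Mapping.update i 0 m) \<longleftrightarrow> x \<in> g ` {..<length xs}" for x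
    proof
      assume "x \<in> Poly_Mapping.keys (Poly_Mapping.update i 0 m)"
      then show "x \<in> g ` {..<length xs}"
        by (auto simp: in_keys_iff lookup_update lm f_def split: if_splits)
    next
      assume "x \<in> g ` {..<length xs}"
      then obtain n where n: "n < length xs" "x = g n" by auto
      then have "x \<noteq> i" using g by auto
      then show "x \<in> Poly_Mapping.keys (Poly_Mapping.update i 0 m)"
        using n pos fg by (simp add: in_keys_iff lookup_update lm)
    qed
    then show ?thesis by blast
  qed
  have "exponents (Poly_Mapping.update i 0 m) = image_mset f (mset_set (g ` {..<length xs}))"
    unfolding exponents_def ku using g by (intro image_mset_cong) (auto simp: lookup_update lm)
  also have "\<dots> = image_mset (\<lambda>n. xs ! n) (mset_set {..<length xs})"
    unfolding image_mset_mset_set[OF g(2), symmetric] multiset.map_comp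
    by (intro image_mset_cong) (auto simp: fg)
  also have "\<dots> = mset xs"
    by (metis atLeast_upt map_nth mset_map mset_set_upto_eq_mset_upto)
  finally have "exponents (Poly_Mapping.update i 0 m) = \<nu>" using xs by simp
  moreover have "Poly_Mapping.keys m \<subseteq> {1..N}"
  proof
    fix x assume "x \<in> Poly_Mapping.keys m"
    then have "x = i \<or> x \<in> g ` {..<length xs}"
      by (auto simp: in_keys_iff lm f_def split: if_splits)
    then show "x \<in> {1..N}" using g(1) assms(1,2) by auto
  qed
  moreover have "Poly_Mapping.lookup m i = d" by (simp add: lm f_def)
  ultimately show ?thesis by blast
qed

lemma ex_sym_expansion:
  assumes "1 \<le> i" "i \<le> N" "F \<in> sym_series N i"
  shows "\<exists>c. sym_expansion N i F c"
proof -
  define Q where "Q d \<nu> m \<longleftrightarrow> Poly_Mapping.keys m \<subseteq> {1..N} \<and> Poly_Mapping.lookup m i = d \<and>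
    exponents (Poly_Mapping.update i 0 m) = \<nu>" for d \<nu> m
  have "F m = (if Poly_Mapping.keys m \<subseteq> {1..N}
     then F (SOME m'. Q (Poly_Mapping.lookup m i) (exponents (Poly_Mapping.update i 0 m)) m') else 0)"
    for m
  proof (cases "Poly_Mapping.keys m \<subseteq> {1..N}")
    case True
    then have "Q (Poly_Mapping.lookup m i) (exponents (Poly_Mapping.update i 0 m)) m"
      by (simp add: Q_def)
    then have "Q (Poly_Mapping.lookup m i) (exponents (Poly_Mapping.update i 0 m))
      (SOME m'. Q (Poly_Mapping.lookup m i) (exponents (Poly_Mapping.update i 0 m)) m')"
      (is "Q _ _ ?m'") by (rule someI)
    then have "F m = F ?m'"
      by (intro sym_series_exponents_cong[OF assms(3) True]) (simp_all only: Q_def)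
    then show ?thesis using True by (simp only: if_True)
  next
    case False
    then show ?thesis using assms(3) by (simp add: sym_series_def)
  qed
  then have "sym_expansion N i F (\<lambda>d \<nu>. F (SOME m. Q d \<nu> m))"
    unfolding sym_expansion_iff[OF assms(1,2)] by blast
  then show ?thesis by blast
qed

lemma sym_coeff_eq:
  assumes "1 \<le> i" "i \<le> N" "F \<in> sym_series N i"
    and "Poly_Mapping.keys m \<subseteq> {1..N}"
  shows "sym_coeff N i F (Poly_Mapping.lookup m i) (exponents (Poly_Mapping.update i 0 m)) = F m"
proof -
  obtain c where c: "sym_expansion N i F c" using ex_sym_expansion assms by blast
  have *: "c' (Poly_Mapping.lookup m i) (exponents (Poly_Mapping.update i 0 m)) = F m"
    if "sym_expansion N i F c'" for c'
    using that assms(4) unfolding sym_expansion_iff[OF assms(1,2)] by simp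
  show ?thesis
    unfolding sym_coeff_def
  proof (rule the_equality)
    show "\<exists>c. sym_expansion N i F c \<and>
        F m = c (Poly_Mapping.lookup m i) (exponents (Poly_Mapping.update i 0 m))"
      using c *[OF c] by (intro exI[of _ c]) simp
  qed (use * in \<open>elim exE conjE, simp only:\<close>)
qed

theorem sym_expansion_sym_coeff:
  assumes "1 \<le> i" "i \<le> N" "F \<in> sym_series N i"
  shows "sym_expansion N i F (sym_coeff N i F)"
  using sym_coeff_eq[OF assms] assms
  by (auto simp: sym_expansion_iff sym_series_def)

lemma (in linorder) sorted_key_list_of_set_props:
  assumes "inj_on h S" "finite S"
  shows "distinct (sorted_key_list_of_set h S)" "set (sorted_key_list_of_set h S) = S"
    "sorted (map h (sorted_key_list_of_set h S))"
proof -
  interpret F: folding_insort_key "(\<le>)" "(<)" S h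
    by unfold_locales (rule assms(1))
  show "distinct (sorted_key_list_of_set h S)"
    using F.distinct_sorted_key_list_of_set[OF subset_refl] by (simp add: distinct_map)
  show "set (sorted_key_list_of_set h S) = S"
    using F.set_sorted_key_list_of_set[OF subset_refl assms(2)] by simp
  show "sorted (map h (sorted_key_list_of_set h S))"
    using F.sorted_sorted_key_list_of_set[OF subset_refl] by simp
qed

lemma blocks_ordered:
  assumes "\<pi> \<in> noncrossing_partitions k"
  shows "distinct (sorted_key_list_of_set Min \<pi>)" "set (sorted_key_list_of_set Min \<pi>) = \<pi>"
    "sorted (map Min (sorted_key_list_of_set Min \<pi>))"
proof -
  have P: "partition_on {1..k} \<pi>" using assms by (simp add: noncrossing_partitions_def)
  have fin: "finite \<pi>" using P finite_elements by blast
  have inj: "inj_on Min \<pi>"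
  proof (rule inj_onI)
    fix A B assume AB: "A \<in> \<pi>" "B \<in> \<pi>" "Min A = Min B"
    have "finite A" "finite B" "A \<noteq> {}" "B \<noteq> {}"
      using AB P partition_onD1[OF P] partition_onD3[OF P]
      by (metis Union_upper finite_atLeastAtMost finite_subset)+
    then have "Min A \<in> A \<inter> B" using AB by (metis IntI Min_in)
    then show "A = B" using partition_onD2[OF P] AB by (auto simp: disjoint_def)
  qed
  show "distinct (sorted_key_list_of_set Min \<pi>)" "set (sorted_key_list_of_set Min \<pi>) = \<pi>"
    "sorted (map Min (sorted_key_list_of_set Min \<pi>))"
    using sorted_key_list_of_set_props[OF inj fin] by simp_all
qed

end

theory Submission
  imports Defs
begin

text \<open>As \<open>N\<close> grows, \<open>C\<^sub>i\<^sub>j\<close> acts on almost every \<open>j\<close> as if \<open>x\<^sub>j\<close> were a fresh variable, so the operators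
  converge to \<open>F \<mapsto> \<theta> (F(x; X) - F(0; x, X)) / x + f F\<close> on series in a variable \<open>x\<close> that are
  symmetric in infinitely many further variables \<open>X\<close>.  Specialize \<open>x = t\<close> and let \<open>X\<close> be the virtual
  alphabet \<open>-t\<close>, i.e. \<open>p\<^sub>k(X) = -t\<^sup>k\<close>.  This is a ring homomorphism; it maps \<open>M\<^sub>\<nu>\<close> to
  \<open>(-1)^\<ell>(\<nu>) P(\<nu>) t^|\<nu>|\<close>, so its coefficients are the free cumulants up to powers of \<open>\<theta>\<close>; and since
  \<open>(x, X)\<close> becomes the empty alphabet, the divided difference becomes the backward shift
  \<open>(G(t) - G(0)) / t\<close>.  What remains is the constant term of \<open>(\<theta> S + \<phi>)^(k - 1) \<gamma>\<close> with one-variable series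
  \<open>\<phi>\<close>, \<open>\<gamma>\<close> and the shift \<open>S\<close>.  Identifying the first two elements of a noncrossing partition gives
  the same recursion for the sum over noncrossing partitions.\<close>


section \<open>Specialization at a virtual alphabet\<close>

definition compositions :: "nat \<Rightarrow> nat list set" where
  "compositions n = {xs. 0 \<notin> set xs \<and> sum_list xs = n}"

text \<open>\<open>F xs\<close> stands for the coefficient of X^xs in a series in an alphabet X,
  where X^xs has the entries of \<open>xs\<close> as its exponents in order. The compositions with a
  given underlying partition are its arrangements, so the signed sum is the coefficient of t^n at
  the virtual alphabet -t.\<close>

definition comp_sum :: "(nat list \<Rightarrow> complex) \<Rightarrow> nat \<Rightarrow> complex" where
  "comp_sum F n = (\<Sum>xs\<in>compositions n. (- 1) ^ length xs * F xs)"

text \<open>With \<open>h d xs\<close> the coefficient of x^d X^xs, this is the coefficient of t^n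
  at x = t and X = -t.\<close>

definition virtual_eval :: "(nat \<Rightarrow> nat list \<Rightarrow> complex) \<Rightarrow> nat \<Rightarrow> complex" where
  "virtual_eval h n = (\<Sum>d\<le>n. comp_sum (h d) (n - d))"

text \<open>The coefficient of X^xs in a product of two series: every exponent is distributed over
  the two factors, one variable at a time.\<close>

primrec list_conv :: "(nat list \<Rightarrow> complex) \<Rightarrow> (nat list \<Rightarrow> complex) \<Rightarrow> nat list \<Rightarrow> complex" where
  "list_conv F G [] = F [] * G []"
| "list_conv F G (r # xs) =
     (\<Sum>s\<le>r. list_conv (\<lambda>ys. F (s # ys)) (\<lambda>ys. G ((r - s) # ys)) xs)"

text \<open>Quasisymmetry: variables with exponent 0 are invisible, while the order of the exponents
  may matter. The cancellation and the product rule below rest on this property.\<close>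

definition zero_insensitive :: "(nat list \<Rightarrow> 'a) \<Rightarrow> bool" where
  "zero_insensitive F \<longleftrightarrow> (\<forall>xs. F xs = F (filter (\<lambda>r. r \<noteq> 0) xs))"

lemma zero_insensitive_Cons: "zero_insensitive F \<Longrightarrow> zero_insensitive (\<lambda>xs. F (r # xs))"
  unfolding zero_insensitive_def
proof
  fix xs assume F: "\<forall>xs. F xs = F (filter (\<lambda>r. r \<noteq> 0) xs)"
  show "F (r # xs) = F (r # filter (\<lambda>r. r \<noteq> 0) xs)"
    by (subst F[rule_format, of "r # xs"], subst F[rule_format, of "r # filter (\<lambda>r. r \<noteq> 0) xs"]) simp
qed

lemma zero_insensitive_Cons_0:
  assumes "zero_insensitive F"
  shows "F (0 # xs) = F xs"
  using assms[unfolded zero_insensitive_def, rule_format, of "0 # xs"]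
    assms[unfolded zero_insensitive_def, rule_format, of xs] by simp

lemma compositions_0: "compositions 0 = {[]}"
proof -
  have "xs = []" if "0 \<notin> set xs" "sum_list xs = 0" for xs :: "nat list"
    using that by (cases xs) auto
  then show ?thesis by (auto simp: compositions_def)
qed

lemma compositions_Suc:
  "compositions (Suc n) = (\<Union>d\<le>n. (#) (Suc d) ` compositions (n - d))" (is "?L = ?R")
proof
  show "?L \<subseteq> ?R"
  proof
    fix xs assume xs: "xs \<in> compositions (Suc n)"
    then obtain r ys where [simp]: "xs = r # ys" by (cases xs) (auto simp: compositions_def)
    from xs have "0 \<notin> set ys" "r \<noteq> 0" "r + sum_list ys = Suc n" by (auto simp: compositions_def)
    moreover then obtain d where "r = Suc d" using not0_implies_Suc by blast
    ultimately have "d \<le> n" "ys \<in> compositions (n - d)" "xs = Suc d # ys"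
      by (auto simp: compositions_def)
    then show "xs \<in> ?R" by blast
  qed
  show "?R \<subseteq> ?L" by (auto simp: compositions_def)
qed

lemma finite_compositions: "finite (compositions n)"
proof (induction n rule: less_induct)
  case (less n)
  show ?case
  proof (cases n)
    case (Suc m)
    then show ?thesis using less by (auto simp: compositions_Suc)
  qed (simp add: compositions_0)
qed

lemma comp_sum_0 [simp]: "comp_sum F 0 = F []"
  by (simp add: comp_sum_def compositions_0)

text \<open>Split off the first part, which is at least 1 and contributes one sign.\<close>

lemma comp_sum_Suc:
  "comp_sum F (Suc n) = - (\<Sum>d\<le>n. comp_sum (\<lambda>xs. F (Suc d # xs)) (n - d))"
proof -
  have "comp_sum F (Suc n) =
      (\<Sum>d\<le>n. \<Sum>xs\<in>(#) (Suc d) ` compositions (n - d). (- 1) ^ length xs * F xs)"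
    unfolding comp_sum_def compositions_Suc
    by (rule sum.UNION_disjoint) (auto simp: finite_compositions)
  also have "\<dots> = (\<Sum>d\<le>n. - comp_sum (\<lambda>xs. F (Suc d # xs)) (n - d))"
    by (intro sum.cong refl) (simp add: sum.reindex comp_sum_def sum_negf)
  finally show ?thesis by (simp add: sum_negf)
qed

lemma comp_sum_sum: "comp_sum (\<lambda>xs. \<Sum>s\<in>S. F s xs) n = (\<Sum>s\<in>S. comp_sum (F s) n)"
  unfolding comp_sum_def sum_distrib_left by (rule sum.swap)

text \<open>Prepending the variable \<open>x = t\<close> cancels against the virtual alphabet \<open>-t\<close>.\<close>

lemma comp_sum_cancel:
  assumes "zero_insensitive F"
  shows "(\<Sum>r\<le>n. comp_sum (\<lambda>xs. F (r # xs)) (n - r)) = (if n = 0 then F [] else 0)"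
proof -
  have F0: "(\<lambda>xs. F (0 # xs)) = F" using zero_insensitive_Cons_0[OF assms] by blast
  show ?thesis
  proof (cases n)
    case (Suc m)
    then show ?thesis by (simp only: sum.atMost_Suc_shift F0 comp_sum_Suc diff_zero) simp
  qed (simp add: F0)
qed

text \<open>Both sides sum u_{s,a} v_{q,b} over all s + a + q + b = n. The left side groups s with
  q, as r = s + q; the right side groups s with a, as p = s + a.\<close>

lemma sum_convolution_product:
  fixes u v :: "nat \<Rightarrow> nat \<Rightarrow> 'a :: comm_semiring_1"
  shows "(\<Sum>r\<le>n. \<Sum>s\<le>r. \<Sum>a\<le>n - r. u s a * v (r - s) (n - r - a)) =
    (\<Sum>p\<le>n. (\<Sum>s\<le>p. u s (p - s)) * (\<Sum>q\<le>n - p. v q (n - p - q)))"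
proof -
  have "(\<Sum>r\<le>n. \<Sum>s\<le>r. \<Sum>a\<le>n - r. u s a * v (r - s) (n - r - a)) =
    (\<Sum>(r, s, a)\<in>(SIGMA r:{..n}. {..r} \<times> {..n - r}). u s a * v (r - s) (n - r - a))"
    by (simp add: sum.Sigma sum.cartesian_product)
  also have "\<dots> = (\<Sum>(p, s, q)\<in>(SIGMA p:{..n}. {..p} \<times> {..n - p}). u s (p - s) * v q (n - p - q))"
    by (rule sum.reindex_bij_witness[where j = "\<lambda>(r, s, a). (s + a, s, r - s)"
          and i = "\<lambda>(p, s, q). (s + q, s, p - s)"]) (auto simp: add.commute)
  also have "\<dots> = (\<Sum>p\<le>n. (\<Sum>s\<le>p. u s (p - s)) * (\<Sum>q\<le>n - p. v q (n - p - q)))"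
    by (simp add: sum.Sigma sum.cartesian_product sum_product)
  finally show ?thesis .
qed

text \<open>Multiplicativity of the specialization follows from \<open>comp_sum_cancel\<close>.
  Prepending a variable and summing over its exponent r gives a product of two cancelled sums, which
  is 0 for n > 0. The terms with r > 0 are known by induction, so the term r = 0 is determined, and
  \<open>comp_sum_Suc\<close> gives the same value for the left side.\<close>

lemma comp_sum_list_conv:
  assumes "zero_insensitive F" "zero_insensitive G"
  shows "comp_sum (list_conv F G) n = (\<Sum>a\<le>n. comp_sum F a * comp_sum G (n - a))"
  using assms
proof (induction n arbitrary: F G rule: less_induct)
  case (less n)
  \<comment> \<open>\<open>?T r\<close> is the claimed right side after the exponent r has been
    prepended to the product, that is, s to the first factor and r - s to the second.\<close>
  let ?T = "\<lambda>r. \<Sum>s\<le>r. \<Sum>a\<le>n - r. comp_sum (\<lambda>xs. F (s # xs)) a *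
        comp_sum (\<lambda>xs. G ((r - s) # xs)) (n - r - a)"
  show ?case
  proof (cases n)
    case (Suc m)
    have F0: "(\<lambda>xs. F (0 # xs)) = F" and G0: "(\<lambda>xs. G (0 # xs)) = G"
      using zero_insensitive_Cons_0 less.prems by blast+
    have "(\<Sum>r\<le>n. ?T r) = (\<Sum>p\<le>n. (if p = 0 then F [] else 0) * (if n - p = 0 then G [] else 0))"
      by (simp only: sum_convolution_product[of "\<lambda>s. comp_sum (\<lambda>xs. F (s # xs))"
            "\<lambda>s. comp_sum (\<lambda>xs. G (s # xs))"] comp_sum_cancel less.prems)
    also have "\<dots> = 0" using Suc by (intro sum.neutral) auto
    finally have a: "?T 0 + (\<Sum>d\<le>m. ?T (Suc d)) = 0" by (simp only: Suc sum.atMost_Suc_shift)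
    have b: "?T 0 = (\<Sum>a\<le>n. comp_sum F a * comp_sum G (n - a))"
      by (simp add: F0 G0)
    have c: "comp_sum (list_conv F G) n = - (\<Sum>d\<le>m. ?T (Suc d))"
    proof -
      have "comp_sum (\<lambda>xs. list_conv F G (Suc d # xs)) (m - d) = ?T (Suc d)" if "d \<le> m" for d
        using that less Suc by (simp add: comp_sum_sum zero_insensitive_Cons del: sum.atMost_Suc)
      then show ?thesis by (simp add: Suc comp_sum_Suc del: list_conv.simps sum.atMost_Suc)
    qed
    show ?thesis by (rule trans[OF c sym[OF eq_neg_iff_add_eq_0[THEN iffD2, OF a[unfolded b]]]])
  qed simp
qed

text \<open>The coefficient of x^d X^xs in \<theta> (F(x; X) - F(0; x, X)) / x + f F. In F(0; x, X)
  the variable x is the first letter of the alphabet, whence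
  \<open>h 0 (Suc d # xs)\<close>.\<close>

definition limit_op :: "complex \<Rightarrow> (nat \<Rightarrow> nat list \<Rightarrow> complex) \<Rightarrow>
    (nat \<Rightarrow> nat list \<Rightarrow> complex) \<Rightarrow> nat \<Rightarrow> nat list \<Rightarrow> complex" where
  "limit_op \<theta> f h d xs = \<theta> * (h (Suc d) xs - h 0 (Suc d # xs)) +
     (\<Sum>s\<le>d. list_conv (f s) (h (d - s)) xs)"

text \<open>By \<open>comp_sum_Suc\<close> the subtracted terms, with their sign, are exactly the
  summand d = 0 of \<open>virtual_eval h (Suc n)\<close>, so the divided difference becomes the
  backward shift. The product term is multiplicativity in x and X together.\<close>

lemma virtual_eval_limit_op:
  assumes "\<And>d. zero_insensitive (f d)" "\<And>d. zero_insensitive (h d)"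
  shows "virtual_eval (limit_op \<theta> f h) n =
    \<theta> * virtual_eval h (Suc n) + (\<Sum>a\<le>n. virtual_eval f a * virtual_eval h (n - a))"
proof -
  have "comp_sum (limit_op \<theta> f h d) j =
      \<theta> * (comp_sum (h (Suc d)) j - comp_sum (\<lambda>xs. h 0 (Suc d # xs)) j) +
      (\<Sum>s\<le>d. comp_sum (list_conv (f s) (h (d - s))) j)" for d j
    unfolding comp_sum_sum[symmetric]
    by (simp add: comp_sum_def limit_op_def algebra_simps sum.distrib sum_distrib_left sum_subtractf)
  then have "virtual_eval (limit_op \<theta> f h) n =
      \<theta> * ((\<Sum>d\<le>n. comp_sum (h (Suc d)) (n - d)) -
        (\<Sum>d\<le>n. comp_sum (\<lambda>xs. h 0 (Suc d # xs)) (n - d))) +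
      (\<Sum>d\<le>n. \<Sum>s\<le>d. \<Sum>a\<le>n - d. comp_sum (f s) a * comp_sum (h (d - s)) (n - d - a))"
    by (simp add: virtual_eval_def sum.distrib sum_subtractf sum_distrib_left right_diff_distrib
        comp_sum_list_conv assms)
  moreover have "(\<Sum>d\<le>n. comp_sum (h (Suc d)) (n - d)) -
      (\<Sum>d\<le>n. comp_sum (\<lambda>xs. h 0 (Suc d # xs)) (n - d)) = virtual_eval h (Suc n)"
    by (simp add: virtual_eval_def sum.atMost_Suc_shift comp_sum_Suc del: sum.atMost_Suc)
  ultimately show ?thesis
    by (simp only: sum_convolution_product[of "\<lambda>s. comp_sum (f s)" "\<lambda>s. comp_sum (h s)"])
       (simp add: virtual_eval_def)
qed

definition partition_fun :: "(nat \<Rightarrow> nat multiset \<Rightarrow> complex) \<Rightarrow> nat \<Rightarrow> nat list \<Rightarrow> complex" where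
  "partition_fun c d xs = c d (mset (filter (\<lambda>r. r \<noteq> 0) xs))"

lemma zero_insensitive_partition_fun: "zero_insensitive (partition_fun c d)"
  by (simp add: zero_insensitive_def partition_fun_def)

text \<open>Group the compositions by their underlying multiset: a partition \<nu> arises from
  P(\<nu>) of them, all with the same sign and coefficient.\<close>

lemma free_cumulant_eq_virtual_eval:
  "free_cumulant \<theta> c (Suc n) = \<theta> ^ n * virtual_eval (partition_fun c) n"
proof -
  have eq: "(\<Sum>xs\<in>permutations_of_multiset \<nu>. (- 1) ^ length xs * partition_fun c d xs) =
      (- 1) ^ size \<nu> * of_nat (card (permutations_of_multiset \<nu>)) * c d \<nu>"
    if "\<nu> \<in> int_partitions" for d \<nu>
  proof -
    have "(- 1) ^ length xs * partition_fun c d xs = (- 1) ^ size \<nu> * c d \<nu>"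
      if xs: "xs \<in> permutations_of_multiset \<nu>" for xs
    proof -
      have m: "mset xs = \<nu>" using xs by (simp add: permutations_of_multiset_def)
      then have "0 \<notin> set xs" using \<open>\<nu> \<in> int_partitions\<close> by (auto simp: int_partitions_def)
      then have "filter (\<lambda>r. r \<noteq> 0) xs = xs" by (auto intro!: filter_True gr0I)
      then show ?thesis using m by (auto simp: partition_fun_def simp flip: size_mset)
    qed
    then show ?thesis by simp
  qed
  let ?P = "{(d, \<nu>). \<nu> \<in> int_partitions \<and> \<Sum>\<^sub># \<nu> + d = n}"
  have "(\<Sum>(d, \<nu>)\<in>?P. (- 1) ^ size \<nu> * of_nat (card (permutations_of_multiset \<nu>)) * c d \<nu>) =
      (\<Sum>(d, \<nu>)\<in>?P. \<Sum>xs\<in>permutations_of_multiset \<nu>. (- 1) ^ length xs * partition_fun c d xs)"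
    by (intro sum.cong refl) (auto simp: eq)
  also have "\<dots> = (\<Sum>((d, \<nu>), xs)\<in>(SIGMA (d, \<nu>):?P. permutations_of_multiset \<nu>).
      (- 1) ^ length xs * partition_fun c d xs)"
    by (subst sum.Sigma[symmetric]) (use finite_partitions_of_weight[of n] in \<open>auto simp: split_def\<close>)
  also have "\<dots> = (\<Sum>(d, xs)\<in>(SIGMA d:{..n}. compositions (n - d)).
      (- 1) ^ length xs * partition_fun c d xs)"
    by (rule sum.reindex_bij_witness[where i = "\<lambda>(d, xs). ((d, mset xs), xs)"
          and j = "\<lambda>((d, \<nu>), xs). (d, xs)"])
       (auto simp: permutations_of_multiset_def compositions_def int_partitions_def sum_mset_sum_list)
  also have "\<dots> = virtual_eval (partition_fun c) n"
    by (simp add: virtual_eval_def comp_sum_def sum.Sigma finite_compositions)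
  finally show ?thesis by (simp add: free_cumulant_def)
qed


section \<open>Coefficients along lists of exponents\<close>

text \<open>A canonical representative, with the exponents on consecutive variables starting at x_i.
  In \<open>list_monomial i (d # xs)\<close> the entry d belongs to x_i, and for i \<ge> 1 all
  variables are available once N \<ge> i + length xs.\<close>

primrec list_monomial :: "nat \<Rightarrow> nat list \<Rightarrow> monomial" where
  "list_monomial i [] = 0"
| "list_monomial i (r # xs) = Poly_Mapping.single i r + list_monomial (Suc i) xs"

lemma lookup_list_monomial:
  "Poly_Mapping.lookup (list_monomial i xs) j =
    (if i \<le> j \<and> j < i + length xs then xs ! (j - i) else 0)"
proof (induction xs arbitrary: i j)
  case (Cons r xs)
  show ?case
    by (cases "j = i") (auto simp: lookup_add lookup_single Cons nth_Cons' less_Suc_eq_le when_def)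
qed simp

lemma keys_list_monomial: "Poly_Mapping.keys (list_monomial i xs) \<subseteq> {i..<i + length xs}"
  by (auto simp: in_keys_iff lookup_list_monomial split: if_splits)

lemma exponents_single_add:
  assumes "Poly_Mapping.lookup m j = 0" "r \<noteq> 0"
  shows "exponents (Poly_Mapping.single j r + m) = add_mset r (exponents m)"
proof -
  let ?m = "Poly_Mapping.single j r + m"
  have k: "Poly_Mapping.keys ?m = insert j (Poly_Mapping.keys m)" and j: "j \<notin> Poly_Mapping.keys m"
    using assms by (auto simp: in_keys_iff lookup_add lookup_single when_def split: if_splits)
  have "image_mset (Poly_Mapping.lookup ?m) (mset_set (Poly_Mapping.keys m)) = exponents m"
    unfolding exponents_def using j
    by (intro image_mset_cong) (auto simp: lookup_add lookup_single when_def)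
  then show ?thesis
    using assms j by (simp add: exponents_def k lookup_add)
qed

lemma exponents_list_monomial: "exponents (list_monomial i xs) = mset (filter (\<lambda>r. r \<noteq> 0) xs)"
proof (induction xs arbitrary: i)
  case (Cons r xs)
  have "Poly_Mapping.lookup (list_monomial (Suc i) xs) i = 0" by (simp add: lookup_list_monomial)
  then show ?case using Cons by (simp add: exponents_single_add)
qed (simp add: exponents_def)

lemma update_list_monomial:
  "Poly_Mapping.update i 0 (list_monomial i (d # xs)) = list_monomial (Suc i) xs"
  by (simp only: monomial_eq_iff)
     (auto simp: lookup_update lookup_add lookup_single when_def lookup_list_monomial)

text \<open>Reduction to the canonical representative. Zeros in \<open>xs\<close> are harmless,
  because the coefficient is determined by d and the nonzero exponents off x_i.\<close>

lemma sym_series_eq_list_monomial: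
  assumes "F \<in> sym_series N i" "i \<ge> 1" "i + length xs \<le> N"
    and "Poly_Mapping.keys m \<subseteq> {1..N}" "Poly_Mapping.lookup m i = d"
    and "exponents (Poly_Mapping.update i 0 m) = mset (filter (\<lambda>r. r \<noteq> 0) xs)"
  shows "F m = F (list_monomial i (d # xs))"
proof (rule sym_series_exponents_cong[OF assms(1)])
  show "Poly_Mapping.keys (list_monomial i (d # xs)) \<subseteq> {1..N}"
    using keys_list_monomial[of i "d # xs"] assms(2,3) by auto
  show "Poly_Mapping.lookup m i = Poly_Mapping.lookup (list_monomial i (d # xs)) i"
    using assms(5) by (simp add: lookup_add lookup_list_monomial)
  show "exponents (Poly_Mapping.update i 0 m) =
      exponents (Poly_Mapping.update i 0 (list_monomial i (d # xs)))"
    by (simp only: assms(6) update_list_monomial exponents_list_monomial)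
qed (use assms in simp)

section \<open>Products and the operators preserve symmetry outside of i\<close>

lemma series_mult_sym_series:
  assumes F: "F \<in> sym_series N i" and G: "G \<in> sym_series N i"
  shows "series_mult F G \<in> sym_series N i"
proof -
  have "series_mult F G m = 0" if m: "\<not> Poly_Mapping.keys m \<subseteq> {1..N}" for m
    unfolding series_mult_def
  proof (rule sum.neutral, rule ballI)
    fix p assume "p \<in> {(a, b). a + b = m}"
    then obtain a b where p: "p = (a, b)" and ab: "a + b = m" by auto
    have "Poly_Mapping.keys m \<subseteq> Poly_Mapping.keys a \<union> Poly_Mapping.keys b"
      using ab by (metis keys_add)
    then have "\<not> Poly_Mapping.keys a \<subseteq> {1..N} \<or> \<not> Poly_Mapping.keys b \<subseteq> {1..N}" using m by blast
    then have "F a = 0 \<or> G b = 0" using F G by (auto simp: sym_series_def)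
    then show "(case p of (a, b) \<Rightarrow> F a * G b) = 0" using p by auto
  qed
  moreover have "series_mult F G (Poly_Mapping.map_key \<sigma> m) = series_mult F G m"
    if \<sigma>: "\<sigma> permutes ({1..N} - {i})" for \<sigma> m
  proof -
    have inj: "inj \<sigma>" "inj (inv \<sigma>)" using \<sigma> permutes_inj permutes_inv by blast+
    have inv1: "Poly_Mapping.map_key \<sigma> (Poly_Mapping.map_key (inv \<sigma>) a) = a"
      and inv2: "Poly_Mapping.map_key (inv \<sigma>) (Poly_Mapping.map_key \<sigma> a) = a" for a :: monomial
      using inj permutes_inverses[OF \<sigma>] by (simp_all add: monomial_eq_iff map_key.rep_eq)
    have add: "Poly_Mapping.map_key \<tau> (a + b) = Poly_Mapping.map_key \<tau> a + Poly_Mapping.map_key \<tau> b"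
      if "inj \<tau>" for \<tau> and a b :: monomial
      using that by (rule map_key_plus)
    have FG: "F (Poly_Mapping.map_key \<tau> a) * G (Poly_Mapping.map_key \<tau> b) = F a * G b"
      if "\<tau> permutes ({1..N} - {i})" for \<tau> a b
      using F G that by (simp add: sym_series_def)
    show ?thesis unfolding series_mult_def
      by (rule sum.reindex_bij_witness[where
            i = "\<lambda>(a, b). (Poly_Mapping.map_key \<sigma> a, Poly_Mapping.map_key \<sigma> b)" and
            j = "\<lambda>(a, b). (Poly_Mapping.map_key (inv \<sigma>) a, Poly_Mapping.map_key (inv \<sigma>) b)"])
         (auto simp: inv1 inv2 inj FG[OF permutes_inv[OF \<sigma>]] simp flip: add)
  qed
  ultimately show ?thesis by (auto simp: sym_series_def)
qed

lemma Q_op_sym_series: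
  assumes f: "f \<in> sym_series N i" and F: "F \<in> sym_series N i" and i: "1 \<le> i" "i \<le> N"
  shows "Q_op \<theta> N i f F \<in> sym_series N i"
proof -
  let ?A = "{1..N} - {i}"
  note fF = series_mult_sym_series[OF f F]
  have "Q_op \<theta> N i f F m = 0" if m: "\<not> Poly_Mapping.keys m \<subseteq> {1..N}" for m
  proof -
    obtain x where x: "x \<in> Poly_Mapping.keys m" "x \<notin> {1..N}" using m by blast
    then have mx: "Poly_Mapping.lookup m x \<noteq> 0" by (simp add: in_keys_iff)
    have F0: "F a = 0" if "Poly_Mapping.lookup a x \<noteq> 0" for a
    proof -
      have "x \<in> Poly_Mapping.keys a" using that by (simp add: in_keys_iff)
      then have "\<not> Poly_Mapping.keys a \<subseteq> {1..N}" using x(2) by blast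
      then show ?thesis using F by (simp add: sym_series_def)
    qed
    have "d_op i F m = 0" using mx by (auto simp: d_op_eq lookup_add intro: F0)
    moreover have "C_op i j F m = 0" if "j \<in> ?A" for j
    proof -
      have "x \<noteq> i" "x \<noteq> j" "i \<noteq> j" using x that i by auto
      then show ?thesis using mx by (auto simp: C_op_eq lookup_update intro!: F0)
    qed
    moreover have "series_mult f F m = 0" using fF m by (auto simp: sym_series_def)
    ultimately show ?thesis by (simp add: Q_op_def)
  qed
  moreover have "Q_op \<theta> N i f F (Poly_Mapping.map_key \<sigma> m) = Q_op \<theta> N i f F m"
    if \<sigma>: "\<sigma> permutes ?A" for \<sigma> m
  proof -
    have inj: "inj \<sigma>" using \<sigma> permutes_inj by blast
    have \<sigma>i: "\<sigma> i = i" using \<sigma> by (auto simp: permutes_not_in)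
    have sym: "F (Poly_Mapping.map_key \<sigma> a) = F a" for a
      using F \<sigma> by (auto simp: sym_series_def)
    have upd: "Poly_Mapping.update j r (Poly_Mapping.map_key \<sigma> a) =
        Poly_Mapping.map_key \<sigma> (Poly_Mapping.update (\<sigma> j) r a)" for j r and a :: monomial
      using inj by (auto simp: monomial_eq_iff map_key.rep_eq lookup_update inj_eq)
    have "Poly_Mapping.map_key \<sigma> m + Poly_Mapping.single i 1 =
        Poly_Mapping.map_key \<sigma> (m + Poly_Mapping.single i 1)"
      using inj \<sigma>i by (auto simp: monomial_eq_iff map_key.rep_eq lookup_add lookup_single when_def)
         (metis inj_eq)+
    then have d: "d_op i F (Poly_Mapping.map_key \<sigma> m) = d_op i F m"
      by (simp add: d_op_eq sym)
    \<comment> \<open>Since \<sigma> fixes i, relabelling turns C_{i,j} into C_{i,\<sigma>(j)}; the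
      sum over all j is then only permuted.\<close>
    have C: "C_op i j F (Poly_Mapping.map_key \<sigma> m) = C_op i (\<sigma> j) F m" if "j \<in> ?A" for j
    proof -
      have "i \<noteq> j" using that by auto
      moreover have "i \<noteq> \<sigma> j" using that \<sigma>i inj by (metis DiffD2 inj_eq singletonI)
      moreover have "Poly_Mapping.update i 0 (Poly_Mapping.map_key \<sigma> m) =
          Poly_Mapping.map_key \<sigma> (Poly_Mapping.update i 0 m)"
        using upd[of i 0 m] \<sigma>i by simp
      ultimately show ?thesis
        using inj by (simp add: C_op_eq upd sym map_key.rep_eq \<sigma>i)
    qed
    have "(\<Sum>j\<in>?A. (d_op i F m - C_op i (\<sigma> j) F m) / of_nat N) =
        (\<Sum>j\<in>?A. (d_op i F m - C_op i j F m) / of_nat N)"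
      using sum.permute[OF \<sigma>, of "\<lambda>j. (d_op i F m - C_op i j F m) / of_nat N"]
      by (simp add: comp_def)
    moreover have "series_mult f F (Poly_Mapping.map_key \<sigma> m) = series_mult f F m"
      using fF \<sigma> by (auto simp: sym_series_def)
    ultimately show ?thesis by (simp add: Q_op_def d C)
  qed
  ultimately show ?thesis by (auto simp: sym_series_def)
qed

text \<open>Peels off one variable: r is distributed over the factors, and what remains is a
  coefficient at a monomial without x_i. This matches the recursion of
  \<open>list_conv\<close>.\<close>

lemma series_mult_single_add:
  assumes m: "Poly_Mapping.lookup m i = 0"
  shows "series_mult F G (Poly_Mapping.single i r + m) =
    (\<Sum>s\<le>r. series_mult (\<lambda>a. F (Poly_Mapping.single i s + a))
      (\<lambda>b. G (Poly_Mapping.single i (r - s) + b)) m)"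
proof -
  let ?S = "\<lambda>m. {(a, b). a + b = (m :: monomial)}"
  let ?u = "Poly_Mapping.update i (0 :: nat)"
  have split: "Poly_Mapping.single i (Poly_Mapping.lookup a i) + ?u a = a" for a
    by (auto simp: monomial_eq_iff lookup_update lookup_add lookup_single when_def)
  have upd: "?u (Poly_Mapping.single i s + a) = a" if "Poly_Mapping.lookup a i = 0" for a s
    using that by (auto simp: monomial_eq_iff lookup_update lookup_add lookup_single when_def)
  have zero: "Poly_Mapping.lookup a i = 0" "Poly_Mapping.lookup b i = 0" if "a + b = m" for a b
    using m that by (auto simp: lookup_add)
  have "series_mult F G (Poly_Mapping.single i r + m) =
      (\<Sum>(s, a, b)\<in>{..r} \<times> ?S m.
        F (Poly_Mapping.single i s + a) * G (Poly_Mapping.single i (r - s) + b))"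
    unfolding series_mult_def
  proof (rule sum.reindex_bij_witness[where
        i = "\<lambda>(s, a, b). (Poly_Mapping.single i s + a, Poly_Mapping.single i (r - s) + b)" and
        j = "\<lambda>(a, b). (Poly_Mapping.lookup a i, ?u a, ?u b)"], goal_cases)
    case (1 p)
    then obtain a b where p: "p = (a, b)" "a + b = Poly_Mapping.single i r + m" by auto
    have "Poly_Mapping.lookup a i + Poly_Mapping.lookup b i = r"
      using arg_cong[OF p(2), of "\<lambda>x. Poly_Mapping.lookup x i"] m by (simp add: lookup_add)
    then have "r - Poly_Mapping.lookup a i = Poly_Mapping.lookup b i" by simp
    then show ?case using split by (simp add: p(1))
  next
    case (2 p)
    then obtain a b where p: "p = (a, b)" "a + b = Poly_Mapping.single i r + m" by auto
    have "Poly_Mapping.lookup a i + Poly_Mapping.lookup b i = r"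
      using arg_cong[OF p(2), of "\<lambda>x. Poly_Mapping.lookup x i"] m by (simp add: lookup_add)
    moreover have "?u a + ?u b = ?u (a + b)"
      by (auto simp: monomial_eq_iff lookup_update lookup_add)
    ultimately show ?case using upd[OF m] by (simp add: p)
  next
    case (3 q)
    then obtain s a b where q: "q = (s, a, b)" "s \<le> r" "a + b = m" by auto
    then show ?case using zero[OF q(3)] by (simp add: upd lookup_add)
  next
    case (4 q)
    then obtain s a b where q: "q = (s, a, b)" "s \<le> r" "a + b = m" by auto
    have "Poly_Mapping.single i s + a + (Poly_Mapping.single i (r - s) + b) =
        Poly_Mapping.single i s + Poly_Mapping.single i (r - s) + (a + b)"
      by (simp only: ac_simps)
    then show ?case using q by (simp flip: single_add)
  next
    case (5 p)
    then obtain a b where p: "p = (a, b)" "a + b = Poly_Mapping.single i r + m" by auto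
    have "Poly_Mapping.lookup a i + Poly_Mapping.lookup b i = r"
      using arg_cong[OF p(2), of "\<lambda>x. Poly_Mapping.lookup x i"] m by (simp add: lookup_add)
    then have "r - Poly_Mapping.lookup a i = Poly_Mapping.lookup b i" by simp
    then show ?case using split by (simp add: p(1))
  qed
  then show ?thesis by (simp add: series_mult_def sum.cartesian_product split_def)
qed

lemma series_mult_list_monomial:
  "series_mult F G (list_monomial i xs) =
    list_conv (\<lambda>ys. F (list_monomial i ys)) (\<lambda>ys. G (list_monomial i ys)) xs"
proof (induction xs arbitrary: i F G)
  case Nil
  have "{(a, b). a + b = (0 :: monomial)} = {(0, 0)}"
    by (auto simp: monomial_eq_iff lookup_add)
  then show ?case by (simp add: series_mult_def)
next
  case (Cons r xs)
  have "Poly_Mapping.lookup (list_monomial (Suc i) xs) i = 0" by (simp add: lookup_list_monomial)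
  then show ?case by (simp add: series_mult_single_add Cons)
qed

section \<open>Limits of coefficients as N grows\<close>

lemma tendsto_list_conv:
  assumes "\<And>ys. (\<lambda>N. F N ys) \<longlonglongrightarrow> f ys" "\<And>ys. (\<lambda>N. G N ys) \<longlonglongrightarrow> g ys"
  shows "(\<lambda>N. list_conv (F N) (G N) xs) \<longlonglongrightarrow> list_conv f g xs"
  using assms
proof (induction xs arbitrary: F f G g)
  case (Cons r xs)
  show ?case unfolding list_conv.simps by (intro tendsto_sum Cons)
qed (simp add: tendsto_mult)

text \<open>The limit is indexed by lists instead of partitions because the limiting operator
  prepends an exponent to a list.\<close>

definition limit_outside :: "nat \<Rightarrow> (nat \<Rightarrow> series) \<Rightarrow> (nat \<Rightarrow> nat list \<Rightarrow> complex) \<Rightarrow> bool" where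
  "limit_outside i F h \<longleftrightarrow> (\<forall>N\<ge>i. F N \<in> sym_series N i) \<and>
     (\<forall>d xs. (\<lambda>N. F N (list_monomial i (d # xs))) \<longlonglongrightarrow> h d xs)"

lemma keys_list_monomial_le:
  assumes "1 \<le> i" "i + length xs \<le> N"
  shows "Poly_Mapping.keys (list_monomial i (d # xs)) \<subseteq> {1..N}"
  using keys_list_monomial[of i "d # xs"] assms by auto

text \<open>By symmetry the two coefficients are equal for all large N, hence so are their
  limits.\<close>

lemma limit_outside_zero_insensitive:
  assumes "1 \<le> i" and lim: "limit_outside i F h"
  shows "zero_insensitive (h d)"
  unfolding zero_insensitive_def
proof
  fix xs :: "nat list"
  let ?ys = "filter (\<lambda>r. r \<noteq> 0) xs"
  have "eventually (\<lambda>N. F N (list_monomial i (d # xs)) = F N (list_monomial i (d # ?ys))) sequentially"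
    using eventually_ge_at_top[of "i + length xs"]
  proof eventually_elim
    case (elim N)
    have "length ?ys \<le> length xs" by simp
    then have "i + length ?ys \<le> N" using elim by linarith
    moreover have "F N \<in> sym_series N i" using lim elim by (simp add: limit_outside_def)
    ultimately show ?case
      using assms(1) keys_list_monomial_le[OF assms(1) elim]
      by (intro sym_series_eq_list_monomial)
         (simp_all add: update_list_monomial[simplified] exponents_list_monomial lookup_add lookup_list_monomial)
  qed
  moreover have xs: "(\<lambda>N. F N (list_monomial i (d # xs))) \<longlonglongrightarrow> h d xs"
    and ys: "(\<lambda>N. F N (list_monomial i (d # ?ys))) \<longlonglongrightarrow> h d ?ys"
    using lim unfolding limit_outside_def by blast+
  ultimately have "(\<lambda>N. F N (list_monomial i (d # ?ys))) \<longlonglongrightarrow> h d xs"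
    by (intro Lim_transform_eventually[OF xs])
  then show "h d xs = h d ?ys" using ys by (rule LIMSEQ_unique)
qed

lemma limit_outside_partition_fun:
  assumes "1 \<le> i" "symmetric_outside i F" "has_limiting_sequence i F c"
  shows "limit_outside i F (partition_fun c)"
proof -
  have sym: "F N \<in> sym_series N i" if "N \<ge> i" for N
    using assms(2) that by (simp add: symmetric_outside_def)
  moreover have "(\<lambda>N. F N (list_monomial i (d # xs))) \<longlonglongrightarrow> partition_fun c d xs" for d xs
  proof -
    let ?\<nu> = "mset (filter (\<lambda>r. r \<noteq> 0) xs)"
    have "(\<lambda>N. sym_coeff N i (F N) d ?\<nu>) \<longlonglongrightarrow> c d ?\<nu>"
      using assms(3) by (auto simp: has_limiting_sequence_def int_partitions_def)
    moreover have "eventually (\<lambda>N. sym_coeff N i (F N) d ?\<nu> = F N (list_monomial i (d # xs))) sequentially"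
      using eventually_ge_at_top[of "i + length xs"]
    proof eventually_elim
      case (elim N)
      have l: "Poly_Mapping.lookup (list_monomial i (d # xs)) i = d"
        by (simp add: lookup_add lookup_list_monomial)
      have "i \<le> N" using elim by simp
      from sym_coeff_eq[OF assms(1) this sym[OF this] keys_list_monomial_le[OF assms(1) elim], of d]
      show ?case unfolding l update_list_monomial exponents_list_monomial .
    qed
    ultimately show ?thesis unfolding partition_fun_def by (rule Lim_transform_eventually)
  qed
  ultimately show ?thesis by (simp add: limit_outside_def)
qed

text \<open>The coefficient of C_{i,j} F vanishes if x_j occurs in the monomial. For every other j
  it is a coefficient of F in which x_i is absent and the fresh variable x_j has exponent d + 1; by
  symmetry it does not depend on j. The bound on N leaves room for this one additional
  variable.\<close>

lemma Q_op_list_monomial: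
  assumes i: "1 \<le> i" and N: "i + Suc (length xs) \<le> N" and F: "F \<in> sym_series N i"
  shows "Q_op \<theta> N i f F (list_monomial i (d # xs)) =
    \<theta> * (of_nat (N - 1) / of_nat N * F (list_monomial i (Suc d # xs)) -
      of_nat (N - Suc (card (Poly_Mapping.keys (list_monomial (Suc i) xs)))) / of_nat N *
        F (list_monomial i (0 # Suc d # xs))) +
    series_mult f F (list_monomial i (d # xs))"
proof -
  let ?m = "list_monomial i (d # xs)" and ?A = "{1..N} - {i}"
  let ?K = "Poly_Mapping.keys (list_monomial (Suc i) xs)"
  let ?v = "F (list_monomial i (0 # Suc d # xs))"
  have lm: "Poly_Mapping.lookup ?m j = Poly_Mapping.lookup (list_monomial (Suc i) xs) j" if "j \<noteq> i" for j
    using that by (simp add: lookup_add lookup_single when_def)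
  have li: "Poly_Mapping.lookup ?m i = d" by (simp add: lookup_add lookup_list_monomial)
  have K: "?K \<subseteq> ?A" using keys_list_monomial[of "Suc i" xs] N i by auto
  have "d_op i F ?m = F (list_monomial i (Suc d # xs))"
  proof -
    have "?m + Poly_Mapping.single i 1 = list_monomial i (Suc d # xs)"
      by (auto simp: monomial_eq_iff lookup_add lookup_single when_def)
    then show ?thesis by (simp only: d_op_eq)
  qed
  moreover have C: "C_op i j F ?m = (if j \<in> ?K then 0 else ?v)" if j: "j \<in> ?A" for j
  proof -
    have ij: "i \<noteq> j" using j by auto
    have jK: "j \<in> ?K \<longleftrightarrow> Poly_Mapping.lookup ?m j \<noteq> 0" using lm[of j] ij by (simp add: in_keys_iff)
    have "F (Poly_Mapping.update j (d + 1) (Poly_Mapping.update i 0 ?m)) = ?v" if "j \<notin> ?K"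
    proof (rule sym_series_eq_list_monomial[OF F i])
      let ?u = "Poly_Mapping.update j (d + 1) (Poly_Mapping.update i 0 ?m)"
      have lj: "Poly_Mapping.lookup (list_monomial (Suc i) xs) j = 0" using that by (simp add: in_keys_iff)
      then have u: "?u = Poly_Mapping.single j (Suc d) + list_monomial (Suc i) xs"
        unfolding update_list_monomial
        by (auto simp: monomial_eq_iff lookup_update lookup_add lookup_single when_def)
      show "Poly_Mapping.keys ?u \<subseteq> {1..N}"
        unfolding u using keys_add[of "Poly_Mapping.single j (Suc d)" "list_monomial (Suc i) xs"] K j
        by auto
      show ui: "Poly_Mapping.lookup ?u i = 0" using ij by (simp add: lookup_update)
      then have uu: "Poly_Mapping.update i 0 ?u = ?u" by (auto simp: monomial_eq_iff lookup_update)
      show "exponents (Poly_Mapping.update i 0 ?u) = mset (filter (\<lambda>r. r \<noteq> 0) (Suc d # xs))"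
        unfolding uu unfolding u exponents_single_add[OF lj nat.distinct(2)] exponents_list_monomial by simp
    qed (use N in simp)
    moreover have "C_op i j F ?m = (if Poly_Mapping.lookup ?m j = 0
        then F (Poly_Mapping.update j (d + 1) (Poly_Mapping.update i 0 ?m)) else 0)"
      using C_op_eq[OF ij, of F ?m] unfolding li .
    ultimately show ?thesis using jK by metis
  qed
  moreover have "(\<Sum>j\<in>?A. C_op i j F ?m) = of_nat (N - Suc (card ?K)) * ?v"
  proof -
    have "(\<Sum>j\<in>?A. C_op i j F ?m) = (\<Sum>j\<in>?A. if j \<in> ?K then 0 else ?v)"
      by (intro sum.cong refl C)
    also have "\<dots> = (\<Sum>j\<in>?A - ?K. ?v)"
      by (rule sum.mono_neutral_cong_right) auto
    also have "\<dots> = of_nat (card (?A - ?K)) * ?v" by simp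
    also have "card (?A - ?K) = N - Suc (card ?K)"
      using K i N by (simp add: card_Diff_subset)
    finally show ?thesis .
  qed
  moreover have "card ?A = N - 1" using i N by simp
  ultimately show ?thesis
    by (simp add: Q_op_def sum_subtractf diff_divide_distrib del: list_monomial.simps
        flip: sum_divide_distrib)
qed

lemma tendsto_of_nat_diff_over_n:
  "(\<lambda>N. of_nat (N - c) / of_nat N :: 'a :: real_normed_field) \<longlonglongrightarrow> 1"
proof (rule Lim_transform_eventually)
  show "(\<lambda>N. 1 - of_nat c / of_nat N :: 'a) \<longlonglongrightarrow> 1"
    using tendsto_diff[OF tendsto_const lim_const_over_n] by fastforce
  show "eventually (\<lambda>N. 1 - of_nat c / of_nat N = (of_nat (N - c) / of_nat N :: 'a)) sequentially"
    using eventually_ge_at_top[of "Suc c"]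
    by eventually_elim (simp add: of_nat_diff diff_divide_distrib)
qed

text \<open>The numbers of all j and of those j whose variable is fresh differ from N by constants,
  so both become 1 after division by N.\<close>

lemma limit_outside_Q_op:
  assumes \<theta>: "\<theta>s \<longlonglongrightarrow> \<theta>" and i: "1 \<le> i"
    and f: "limit_outside i f hf" and F: "limit_outside i F h"
  shows "limit_outside i (\<lambda>N. Q_op (\<theta>s N) N i (f N) (F N)) (limit_op \<theta> hf h)"
  unfolding limit_outside_def
proof (intro conjI allI impI)
  fix N assume "i \<le> N"
  then show "Q_op (\<theta>s N) N i (f N) (F N) \<in> sym_series N i"
    using f F i by (intro Q_op_sym_series) (auto simp: limit_outside_def)
next
  fix d xs
  let ?c = "Suc (card (Poly_Mapping.keys (list_monomial (Suc i) xs)))"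
  have fl: "(\<lambda>N. f N (list_monomial i (d # xs))) \<longlonglongrightarrow> hf d xs"
    and Fl: "(\<lambda>N. F N (list_monomial i (d # xs))) \<longlonglongrightarrow> h d xs" for d xs
    using f F unfolding limit_outside_def by blast+
  have "(\<lambda>N. series_mult (f N) (F N) (list_monomial i (d # xs))) \<longlonglongrightarrow>
      (\<Sum>s\<le>d. list_conv (hf s) (h (d - s)) xs)"
    unfolding series_mult_list_monomial list_conv.simps
    by (intro tendsto_sum tendsto_list_conv fl Fl)
  then have "(\<lambda>N. \<theta>s N * (of_nat (N - 1) / of_nat N * F N (list_monomial i (Suc d # xs)) -
      of_nat (N - ?c) / of_nat N * F N (list_monomial i (0 # Suc d # xs))) +
      series_mult (f N) (F N) (list_monomial i (d # xs))) \<longlonglongrightarrow>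
    \<theta> * (1 * h (Suc d) xs - 1 * h 0 (Suc d # xs)) + (\<Sum>s\<le>d. list_conv (hf s) (h (d - s)) xs)"
    by (intro tendsto_intros \<theta> tendsto_of_nat_diff_over_n Fl)
  moreover have "eventually (\<lambda>N. \<theta>s N * (of_nat (N - 1) / of_nat N * F N (list_monomial i (Suc d # xs)) -
      of_nat (N - ?c) / of_nat N * F N (list_monomial i (0 # Suc d # xs))) +
      series_mult (f N) (F N) (list_monomial i (d # xs)) =
      Q_op (\<theta>s N) N i (f N) (F N) (list_monomial i (d # xs))) sequentially"
    using eventually_ge_at_top[of "i + Suc (length xs)"]
  proof eventually_elim
    case (elim N)
    have "F N \<in> sym_series N i" using F elim by (simp add: limit_outside_def)
    then show ?case by (rule Q_op_list_monomial[OF i elim, symmetric])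
  qed
  ultimately show "(\<lambda>N. Q_op (\<theta>s N) N i (f N) (F N) (list_monomial i (d # xs))) \<longlonglongrightarrow>
      limit_op \<theta> hf h d xs"
    unfolding limit_op_def mult_1 by (rule Lim_transform_eventually)
qed


section \<open>Sums over noncrossing partitions\<close>

text \<open>A directed relation: the lowest of the four points lies in \<open>A\<close>. A root
  block has to be tested in both directions.\<close>

definition crossing :: "nat set \<Rightarrow> nat set \<Rightarrow> bool" where
  "crossing A B \<longleftrightarrow> (\<exists>a b c d. a < b \<and> b < c \<and> c < d \<and> a \<in> A \<and> c \<in> A \<and> b \<in> B \<and> d \<in> B)"

text \<open>A noncrossing partition of \<open>{n..k}\<close>, with the block of \<open>n\<close> split off.\<close>

definition rooted_nc :: "nat \<Rightarrow> nat \<Rightarrow> (nat set \<times> nat set set) set" where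
  "rooted_nc n k = {(B, \<rho>). n \<in> B \<and> B \<subseteq> {n..k} \<and> partition_on ({n..k} - B) \<rho> \<and>
     (\<forall>C\<in>\<rho>. \<not> crossing B C \<and> \<not> crossing C B) \<and>
     (\<forall>C\<in>\<rho>. \<forall>D\<in>\<rho>. C \<noteq> D \<longrightarrow> \<not> crossing C D)}"

text \<open>Sequences are indexed by block size minus one, so \<open>\<phi> n\<close> takes the
  place of c_{n+1}. The root block has its own weight \<open>\<gamma>\<close>.\<close>

definition nc_weight ::
  "(nat \<Rightarrow> 'a :: comm_semiring_1) \<Rightarrow> (nat \<Rightarrow> 'a) \<Rightarrow> nat set \<times> nat set set \<Rightarrow> 'a" where
  "nc_weight \<phi> \<gamma> = (\<lambda>(B, \<rho>). \<gamma> (card B - 1) * (\<Prod>C\<in>\<rho>. \<phi> (card C - 1)))"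

lemma finite_rooted_nc: "finite (rooted_nc n k)"
proof (rule finite_subset)
  show "rooted_nc n k \<subseteq> Pow {n..k} \<times> Pow (Pow {n..k})"
    by (auto simp: rooted_nc_def dest: partition_onD1)
qed auto

lemma rooted_ncD:
  assumes "(B, \<rho>) \<in> rooted_nc n k"
  shows "n \<in> B" "B \<subseteq> {n..k}" "finite B" "finite \<rho>" "{} \<notin> \<rho>" "\<Union>\<rho> = {n..k} - B"
    "\<And>C. C \<in> \<rho> \<Longrightarrow> finite C"
    "\<And>C D. C \<in> \<rho> \<Longrightarrow> D \<in> \<rho> \<Longrightarrow> C \<noteq> D \<Longrightarrow> C \<inter> D = {}"
    "\<And>C. C \<in> \<rho> \<Longrightarrow> \<not> crossing B C" "\<And>C. C \<in> \<rho> \<Longrightarrow> \<not> crossing C B"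
    "\<And>C D. C \<in> \<rho> \<Longrightarrow> D \<in> \<rho> \<Longrightarrow> C \<noteq> D \<Longrightarrow> \<not> crossing C D"
proof -
  have p: "partition_on ({n..k} - B) \<rho>" using assms by (simp add: rooted_nc_def)
  show "n \<in> B" and B: "B \<subseteq> {n..k}" using assms by (auto simp: rooted_nc_def)
  show "finite B" using B finite_subset by blast
  show "finite \<rho>" using p finite_elements by blast
  show "{} \<notin> \<rho>" and U: "\<Union>\<rho> = {n..k} - B" using p by (auto dest: partition_onD1 partition_onD3)
  show "finite C" if "C \<in> \<rho>" for C
    using that U by (metis Union_upper finite_Diff finite_atLeastAtMost finite_subset)
  show "C \<inter> D = {}" if "C \<in> \<rho>" "D \<in> \<rho>" "C \<noteq> D" for C D
    using partition_onD2[OF p] that by (auto simp: disjoint_def)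
  have *: "\<forall>C\<in>\<rho>. \<not> crossing B C \<and> \<not> crossing C B"
    "\<forall>C\<in>\<rho>. \<forall>D\<in>\<rho>. C \<noteq> D \<longrightarrow> \<not> crossing C D"
    using assms[unfolded rooted_nc_def mem_Collect_eq prod.case] by - (elim conjE, assumption)+
  show "\<And>C. C \<in> \<rho> \<Longrightarrow> \<not> crossing B C" "\<And>C. C \<in> \<rho> \<Longrightarrow> \<not> crossing C B"
    "\<And>C D. C \<in> \<rho> \<Longrightarrow> D \<in> \<rho> \<Longrightarrow> C \<noteq> D \<Longrightarrow> \<not> crossing C D"
    using *(1) *(1) *(2) by metis+
qed

lemma rooted_ncI:
  assumes "n \<in> B" "B \<subseteq> {n..k}" "{} \<notin> \<rho>" "\<Union>\<rho> = {n..k} - B"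
    "\<And>C D. C \<in> \<rho> \<Longrightarrow> D \<in> \<rho> \<Longrightarrow> C \<noteq> D \<Longrightarrow> C \<inter> D = {}"
    "\<And>C. C \<in> \<rho> \<Longrightarrow> \<not> crossing B C" "\<And>C. C \<in> \<rho> \<Longrightarrow> \<not> crossing C B"
    "\<And>C D. C \<in> \<rho> \<Longrightarrow> D \<in> \<rho> \<Longrightarrow> C \<noteq> D \<Longrightarrow> \<not> crossing C D"
  shows "(B, \<rho>) \<in> rooted_nc n k"
proof -
  have "partition_on ({n..k} - B) \<rho>"
    using assms(3-5) by (intro partition_onI) (simp_all add: disjnt_def)
  then show ?thesis using assms by (simp add: rooted_nc_def)
qed

section \<open>Moving the root from n to n + 1 and back\<close>

lemma not_crossing_subset: "\<not> crossing A' B' \<Longrightarrow> A \<subseteq> A' \<Longrightarrow> B \<subseteq> B' \<Longrightarrow> \<not> crossing A B"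
proof
  assume *: "\<not> crossing A' B'" "A \<subseteq> A'" "B \<subseteq> B'" "crossing A B"
  then obtain a b c d where o: "a < b" "b < c" "c < d" and "a \<in> A" "c \<in> A" "b \<in> B" "d \<in> B"
    unfolding crossing_def by blast
  then have "a \<in> A'" "c \<in> A'" "b \<in> B'" "d \<in> B'" using *(2,3) by auto
  then show False using *(1) o unfolding crossing_def by blast
qed

text \<open>The element \<open>n\<close> either joins the block of \<open>n + 1\<close>, \<dots>\<close>

lemma rooted_nc_insert:
  assumes "(B, \<rho>) \<in> rooted_nc (Suc n) k"
  shows "(insert n B, \<rho>) \<in> rooted_nc n k"
proof -
  note D = rooted_ncD[OF assms]
  have le: "n < k" using D(1,2) by auto
  have gt: "n < x" if "C \<in> \<rho>" "x \<in> C" for x C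
  proof -
    have "x \<in> \<Union>\<rho>" using that by blast
    then show ?thesis using D(6) by auto
  qed
  have ne: "x \<noteq> Suc n" if "C \<in> \<rho>" "x \<in> C" for x C
  proof -
    have "x \<in> \<Union>\<rho>" using that by blast
    then show ?thesis using D(1,6) by auto
  qed
  show ?thesis
  proof (rule rooted_ncI)
    show "\<And>C E. C \<in> \<rho> \<Longrightarrow> E \<in> \<rho> \<Longrightarrow> C \<noteq> E \<Longrightarrow> C \<inter> E = {}" by (rule D(8))
    show "\<And>C E. C \<in> \<rho> \<Longrightarrow> E \<in> \<rho> \<Longrightarrow> C \<noteq> E \<Longrightarrow> \<not> crossing C E" by (rule D(11))
    show "insert n B \<subseteq> {n..k}" using D(2) le by auto
    show "\<Union>\<rho> = {n..k} - insert n B" using D(2,6) le by (auto simp: Suc_le_eq)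
    fix C assume C: "C \<in> \<rho>"
    show "\<not> crossing (insert n B) C"
    proof
      assume "crossing (insert n B) C"
      then obtain a b c d where *: "a < b" "b < c" "c < d" "a \<in> insert n B" "c \<in> insert n B" "b \<in> C" "d \<in> C"
        unfolding crossing_def by blast
      have b: "Suc n < b" using gt[OF C *(6)] ne[OF C *(6)] by simp
      have "c \<in> B" using * b by auto
      then have "crossing B C"
        unfolding crossing_def using * b D(1) by (cases "a = n") blast+
      then show False using D(9) C by blast
    qed
    show "\<not> crossing C (insert n B)"
    proof
      assume "crossing C (insert n B)"
      then obtain a b c d where *: "a < b" "b < c" "c < d" "a \<in> C" "c \<in> C" "b \<in> insert n B" "d \<in> insert n B"
        unfolding crossing_def by blast
      have "b \<in> B" "d \<in> B" using * gt[OF C] by (metis insertE less_trans less_irrefl)+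
      then have "crossing C B" unfolding crossing_def using * by blast
      then show False using D(10) C by blast
    qed
  qed (use D(5) in simp_all)
qed

text \<open>Inverse to \<open>rooted_nc_insert\<close>: subsets of noncrossing blocks do not cross,
  and n + 1 is the new root.\<close>

lemma rooted_nc_remove:
  assumes "(B, \<rho>) \<in> rooted_nc n k" "Suc n \<in> B"
  shows "(B - {n}, \<rho>) \<in> rooted_nc (Suc n) k"
proof -
  note D = rooted_ncD[OF assms(1)]
  have "\<not> crossing (B - {n}) C" "\<not> crossing C (B - {n})" if "C \<in> \<rho>" for C
    using not_crossing_subset[OF D(9)[OF that]] not_crossing_subset[OF D(10)[OF that]] by auto
  moreover have "\<Union>\<rho> = {Suc n..k} - (B - {n})" using D(1,6) by (auto simp: Suc_le_eq)
  moreover have "B - {n} \<subseteq> {Suc n..k}" using D(2) by force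
  ultimately show ?thesis by (intro rooted_ncI) (use assms(2) in \<open>simp_all add: D(5) D(8) D(11)\<close>)
qed

text \<open>\<dots> or it cuts that block after some element \<open>t\<close> and takes over the upper part.\<close>

lemma rooted_nc_cut:
  assumes "(B, \<rho>) \<in> rooted_nc (Suc n) k" "t \<in> B"
  shows "(insert n {x\<in>B. x > t}, insert {x\<in>B. x \<le> t} \<rho>) \<in> rooted_nc n k"
proof -
  note D = rooted_ncD[OF assms(1)]
  let ?U = "{x\<in>B. x > t}" and ?L = "{x\<in>B. x \<le> t}"
  \<comment> \<open>The new root block is contained in \<open>insert n B\<close>, so joining n first
    settles its crossings with the blocks of \<rho>.\<close>
  note D' = rooted_ncD[OF rooted_nc_insert[OF assms(1)]]
  have le: "n < k" using D(1,2) by auto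
  have B: "n < x" if "x \<in> B" for x using that D(2) by auto
  have t: "Suc n \<le> t" using B[OF assms(2)] by simp
  show ?thesis
  proof (rule rooted_ncI)
    have "?L \<subseteq> B" by blast
    then have L: "\<not> crossing ?L C" "\<not> crossing C ?L" "?L \<inter> C = {}" if "C \<in> \<rho>" for C
      using not_crossing_subset[OF D(9)[OF that]] not_crossing_subset[OF D(10)[OF that]] D(6) that
      by auto
    have "insert n ?U \<subseteq> insert n B" by blast
    then have U: "\<not> crossing (insert n ?U) C" "\<not> crossing C (insert n ?U)" if "C \<in> \<rho>" for C
      using not_crossing_subset[OF D'(9)[OF that]] not_crossing_subset[OF D'(10)[OF that]] by auto
    \<comment> \<open>\<open>?L\<close> lies strictly above n and strictly below all of
      \<open>?U\<close>, which excludes crossings in either direction.\<close>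
    have "\<not> crossing (insert n ?U) ?L"
    proof
      assume "crossing (insert n ?U) ?L"
      then obtain b c d where "b < c" "c < d" "c \<in> insert n ?U" "b \<in> ?L" "d \<in> ?L"
        unfolding crossing_def by blast
      then show False using B[of b] by auto
    qed
    then show "\<not> crossing (insert n ?U) C" if "C \<in> insert ?L \<rho>" for C
      using that U by blast
    have "\<not> crossing ?L (insert n ?U)"
    proof
      assume "crossing ?L (insert n ?U)"
      then obtain a b c where "a < b" "b < c" "a \<in> ?L" "c \<in> ?L" "b \<in> insert n ?U"
        unfolding crossing_def by blast
      then show False using B[of a] by auto
    qed
    then show "\<not> crossing C (insert n ?U)" if "C \<in> insert ?L \<rho>" for C
      using that U by blast
    show "C \<inter> E = {}" if "C \<in> insert ?L \<rho>" "E \<in> insert ?L \<rho>" "C \<noteq> E" for C E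
      using that L(3) D(8) by (metis Int_commute insertE)
    show "\<not> crossing C E" if "C \<in> insert ?L \<rho>" "E \<in> insert ?L \<rho>" "C \<noteq> E" for C E
      using that L(1,2) D(11) by (metis insertE)
    show "\<Union>(insert ?L \<rho>) = {n..k} - insert n ?U"
    proof -
      have "\<Union>(insert ?L \<rho>) = ?L \<union> ({Suc n..k} - B)" using D(6) by auto
      also have "\<dots> = {n..k} - insert n ?U" using D(2) by (auto simp: Suc_le_eq)
      finally show ?thesis .
    qed
    show "insert n ?U \<subseteq> {n..k}" using D(2) le by auto
    have "?L \<noteq> {}" using assms(2) by auto
    then show "{} \<notin> insert ?L \<rho>" using D(5) by blast
  qed simp
qed

text \<open>Otherwise n < n + 1 < b < c, with n and b in \<open>B\<close> and n + 1 and c in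
  \<open>C\<close>, would be a crossing.\<close>

lemma rooted_nc_below:
  assumes "(B, \<rho>) \<in> rooted_nc n k" "C \<in> \<rho>" "Suc n \<in> C" "b \<in> B" "b \<noteq> n" "c \<in> C"
  shows "c < b"
proof (rule ccontr)
  note D = rooted_ncD[OF assms(1)]
  assume "\<not> c < b"
  have "C \<inter> B = {}" using D(6) assms(2) by blast
  then have "b \<noteq> c" "b \<noteq> Suc n" using assms by blast+
  moreover have "n \<le> b" using D(2) assms(4) by auto
  ultimately have "n < Suc n" "Suc n < b" "b < c" using \<open>\<not> c < b\<close> assms(5) by auto
  then have "crossing B C" unfolding crossing_def using D(1) assms by blast
  then show False using D(9) assms(2) by blast
qed

text \<open>Inverse to the cut. By \<open>rooted_nc_below\<close> the block \<open>C\<close> lies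
  below the rest of the root block. A crossing of the glued block with a third block therefore
  yields one of \<open>B\<close> or \<open>C\<close> with that block, if necessary with n or n + 1
  supplied as lowest point.\<close>

lemma rooted_nc_merge:
  assumes "(B, \<rho>) \<in> rooted_nc n k" "C \<in> \<rho>" "Suc n \<in> C"
  shows "((B - {n}) \<union> C, \<rho> - {C}) \<in> rooted_nc (Suc n) k"
proof -
  note D = rooted_ncD[OF assms(1)]
  note below = rooted_nc_below[OF assms]
  have CB: "C \<inter> B = {}" using D(6) assms(2) by blast
  have Ck: "C \<subseteq> {n..k} - B" using D(6) assms(2) by blast
  have CA: "\<Union>(\<rho> - {C}) = \<Union>\<rho> - C" using D(8)[OF assms(2)] by blast
  have gt: "Suc n < x" if "E \<in> \<rho>" "E \<noteq> C" "x \<in> E" for x E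
  proof -
    have "E \<subseteq> {n..k} - B" "C \<inter> E = {}" using D(6,8) assms(2) that by blast+
    then have "n \<le> x" "x \<noteq> n" "x \<noteq> Suc n" using D(1) that(3) assms(3) by auto
    then show ?thesis by simp
  qed
  show ?thesis
  proof (rule rooted_ncI)
    show "D \<inter> E = {}" if "D \<in> \<rho> - {C}" "E \<in> \<rho> - {C}" "D \<noteq> E" for D E
      using that by (intro D(8)) auto
    show "\<not> crossing D E" if "D \<in> \<rho> - {C}" "E \<in> \<rho> - {C}" "D \<noteq> E" for D E
      using that by (intro D(11)) auto
    show "B - {n} \<union> C \<subseteq> {Suc n..k}"
    proof
      fix x assume "x \<in> B - {n} \<union> C"
      then have "x \<in> {n..k}" "x \<noteq> n" using D(1,2) Ck by auto
      then show "x \<in> {Suc n..k}" by auto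
    qed
    show "\<Union>(\<rho> - {C}) = {Suc n..k} - (B - {n} \<union> C)"
    proof -
      have "{n..k} - {n} = {Suc n..k}" by auto
      then show ?thesis unfolding CA D(6) using D(1) by blast
    qed
    fix E assume E: "E \<in> \<rho> - {C}"
    show "\<not> crossing (B - {n} \<union> C) E"
    proof
      assume "crossing (B - {n} \<union> C) E"
      then obtain a b c d where *: "a < b" "b < c" "c < d" "a \<in> B - {n} \<union> C" "c \<in> B - {n} \<union> C"
          "b \<in> E" "d \<in> E"
        unfolding crossing_def by blast
      have nb: "n < b" using gt[of E b] E * by auto
      consider "c \<in> B" | "c \<in> C" "a \<in> C" | "c \<in> C" "a \<in> B - {n}" using * by blast
      then show False
      proof cases
        case 1
        then have "crossing B E" unfolding crossing_def using * nb D(1) by blast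
        then show False using D(9) E by blast
      next
        case 2
        then have "crossing C E" unfolding crossing_def using * by blast
        then show False using D(11)[OF assms(2), of E] E by blast
      next
        case 3
        then show False using below[of a c] * by auto
      qed
    qed
    show "\<not> crossing E (B - {n} \<union> C)"
    proof
      assume "crossing E (B - {n} \<union> C)"
      then obtain a b c d where *: "a < b" "b < c" "c < d" "a \<in> E" "c \<in> E"
          "b \<in> B - {n} \<union> C" "d \<in> B - {n} \<union> C"
        unfolding crossing_def by blast
      have na: "Suc n < a" using gt[of E a] E * by auto
      consider "b \<in> C" | "b \<in> B" "d \<in> B" | "b \<in> B - {n}" "d \<in> C" using * by blast
      then show False
      proof cases
        case 1
        then have "crossing C E" unfolding crossing_def using * na assms(3) by blast
        then show False using D(11)[OF assms(2), of E] E by blast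
      next
        case 2
        then have "crossing E B" unfolding crossing_def using * by blast
        then show False using D(10) E by blast
      next
        case 3
        then show False using below[of b d] * by auto
      qed
    qed
  qed (use D(5) assms(3) in simp_all)
qed

section \<open>Counting the cuts and the resulting recursion\<close>

lemma sum_card_cut:
  fixes h :: "nat \<Rightarrow> nat \<Rightarrow> 'a :: comm_monoid_add" and B :: "nat set"
  assumes "finite B" "card B = Suc s"
  shows "(\<Sum>t\<in>B. h (card {x\<in>B. x \<le> t} - 1) (card {x\<in>B. x > t})) = (\<Sum>a\<le>s. h a (s - a))"
proof -
  \<comment> \<open>The rank of t in \<open>B\<close>, counted from 0. It maps \<open>B\<close>
    bijectively onto {..s}, and s minus the rank is the number of elements above t.\<close>
  let ?r = "\<lambda>t. card {x\<in>B. x \<le> t} - 1"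
  have pos: "card {x\<in>B. x \<le> t} > 0" if "t \<in> B" for t
    using that assms(1) by (auto simp: card_gt_0_iff)
  have tot: "card {x\<in>B. x \<le> t} + card {x\<in>B. x > t} = Suc s" for t
  proof -
    have "card {x\<in>B. x \<le> t} + card {x\<in>B. x > t} = card ({x\<in>B. x \<le> t} \<union> {x\<in>B. x > t})"
      using assms(1) by (intro card_Un_disjoint[symmetric]) auto
    also have "{x\<in>B. x \<le> t} \<union> {x\<in>B. x > t} = B" by auto
    finally show ?thesis using assms(2) by simp
  qed
  have less: "?r t < ?r u" if "t \<in> B" "u \<in> B" "t < u" for t u
  proof -
    have "card {x\<in>B. x \<le> t} < card {x\<in>B. x \<le> u}"
    proof (rule psubset_card_mono)
      have "u \<in> {x\<in>B. x \<le> u}" "u \<notin> {x\<in>B. x \<le> t}" using that by auto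
      moreover have "{x\<in>B. x \<le> t} \<subseteq> {x\<in>B. x \<le> u}" using that(3) by auto
      ultimately show "{x\<in>B. x \<le> t} \<subset> {x\<in>B. x \<le> u}" by blast
    qed (use assms(1) in simp)
    then show ?thesis using pos[OF that(1)] by linarith
  qed
  have inj: "inj_on ?r B"
    by (rule linorder_inj_onI) (use less in \<open>force simp: linorder_neq_iff\<close>)+
  have "?r ` B \<subseteq> {..s}"
  proof
    fix a assume "a \<in> ?r ` B"
    then obtain t where "a = ?r t" by blast
    then show "a \<in> {..s}" using tot[of t] by simp
  qed
  moreover have "card (?r ` B) = card {..s}" using card_image[OF inj] assms(2) by simp
  ultimately have im: "?r ` B = {..s}" by (intro card_subset_eq) auto
  have "(\<Sum>a\<le>s. h a (s - a)) = (\<Sum>t\<in>B. h (?r t) (s - ?r t))"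
    unfolding im[symmetric] sum.reindex[OF inj] comp_def ..
  also have "\<dots> = (\<Sum>t\<in>B. h (?r t) (card {x\<in>B. x > t}))"
  proof (rule sum.cong)
    fix t assume "t \<in> B"
    then have "s - ?r t = card {x\<in>B. x > t}" using tot[of t] pos[of t] by linarith
    then show "h (?r t) (s - ?r t) = h (?r t) (card {x\<in>B. x > t})" by simp
  qed simp
  finally show ?thesis by simp
qed

text \<open>The operator S + \<phi> on one-variable series: backward shift plus multiplication by
  the series with coefficients \<open>\<phi>\<close>.\<close>

definition cumulant_step ::
  "(nat \<Rightarrow> 'a :: comm_semiring_1) \<Rightarrow> (nat \<Rightarrow> 'a) \<Rightarrow> nat \<Rightarrow> 'a" where
  "cumulant_step \<phi> \<gamma> s = \<gamma> (Suc s) + (\<Sum>a\<le>s. \<phi> a * \<gamma> (s - a))"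

text \<open>Identify n with n + 1. Above a partition with root block \<open>B\<close> of size s + 1
  lie the one where n joins \<open>B\<close>, giving \<open>\<gamma> (Suc s)\<close>, and one for
  each cut t \<in> \<open>B\<close>, giving \<open>\<phi> a * \<gamma> (s - a)\<close> with a the
  rank of t.\<close>

lemma sum_rooted_nc_step:
  assumes "n < k"
  shows "(\<Sum>p\<in>rooted_nc n k. nc_weight \<phi> \<gamma> p) =
    (\<Sum>p\<in>rooted_nc (Suc n) k. nc_weight \<phi> (cumulant_step \<phi> \<gamma>) p)"
proof -
  let ?R = "rooted_nc n k" and ?R' = "rooted_nc (Suc n) k"
  let ?joined = "{p \<in> ?R. Suc n \<in> fst p}" and ?cut = "{p \<in> ?R. Suc n \<notin> fst p}"
  have n_notin: "n \<notin> B" if "(B, \<rho>) \<in> ?R'" for B \<rho> using rooted_ncD(2)[OF that] by auto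
  have "?R = ?joined \<union> ?cut" by blast
  then have "(\<Sum>p\<in>?R. nc_weight \<phi> \<gamma> p) =
      (\<Sum>p\<in>?joined. nc_weight \<phi> \<gamma> p) + (\<Sum>p\<in>?cut. nc_weight \<phi> \<gamma> p)"
    using finite_rooted_nc[of n k] by (subst sum.union_disjoint[symmetric]) auto
  also have "(\<Sum>p\<in>?joined. nc_weight \<phi> \<gamma> p) =
      (\<Sum>(B, \<rho>)\<in>?R'. \<gamma> (card B) * (\<Prod>C\<in>\<rho>. \<phi> (card C - 1)))"
  proof (rule sum.reindex_bij_witness[where j = "\<lambda>(B, \<rho>). (B - {n}, \<rho>)"
        and i = "\<lambda>(B, \<rho>). (insert n B, \<rho>)"], goal_cases)
    case (1 p)
    then show ?case by (cases p) (auto dest: rooted_ncD(1))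
  next
    case (2 p)
    then show ?case by (cases p) (auto intro: rooted_nc_remove)
  next
    case (3 p)
    then show ?case by (cases p) (auto dest: n_notin)
  next
    case (4 p)
    then show ?case by (cases p) (auto intro: rooted_nc_insert dest: rooted_ncD(1))
  next
    case (5 p)
    then show ?case by (cases p) (auto simp: nc_weight_def dest: rooted_ncD(1,3))
  qed
  also have "(\<Sum>p\<in>?cut. nc_weight \<phi> \<gamma> p) = (\<Sum>((B, \<rho>), t)\<in>(SIGMA p:?R'. fst p).
      \<gamma> (card {x\<in>B. x > t}) * (\<phi> (card {x\<in>B. x \<le> t} - 1) * (\<Prod>C\<in>\<rho>. \<phi> (card C - 1))))"
  proof -
    \<comment> \<open>The block of n + 1 when n is not in it; its maximum recovers the cut
      point.\<close>
    let ?C = "\<lambda>\<rho>. THE C. C \<in> \<rho> \<and> Suc n \<in> C"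
    have C: "?C \<rho> \<in> \<rho>" "Suc n \<in> ?C \<rho>" if "(B, \<rho>) \<in> ?R" "Suc n \<notin> B" for B \<rho>
    proof -
      note D = rooted_ncD[OF that(1)]
      have "Suc n \<in> \<Union>\<rho>" using D(6) that(2) assms by auto
      then have "\<exists>!C. C \<in> \<rho> \<and> Suc n \<in> C" using D(8) by blast
      then have "?C \<rho> \<in> \<rho> \<and> Suc n \<in> ?C \<rho>" by (rule theI')
      then show "?C \<rho> \<in> \<rho>" "Suc n \<in> ?C \<rho>" by auto
    qed
    have Ceq: "?C (insert {x\<in>B. x \<le> t} \<rho>) = {x\<in>B. x \<le> t}"
      and notin: "{x\<in>B. x \<le> t} \<notin> \<rho>" if "(B, \<rho>) \<in> ?R'" "t \<in> B" for B \<rho> t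
    proof -
      note D = rooted_ncD[OF that(1)]
      have "Suc n \<in> {x\<in>B. x \<le> t}" using D(1,2) that(2) by auto
      moreover have "Suc n \<notin> C" if "C \<in> \<rho>" for C using D(1,6) that by blast
      ultimately show "?C (insert {x\<in>B. x \<le> t} \<rho>) = {x\<in>B. x \<le> t}" "{x\<in>B. x \<le> t} \<notin> \<rho>"
        by (blast intro!: the_equality)+
    qed
    \<comment> \<open>Cutting the merged block at this maximum returns the two original pieces, as
      \<open>?C \<rho>\<close> lies below B - {n}.\<close>
    have up: "{x \<in> B - {n} \<union> ?C \<rho>. x > Max (?C \<rho>)} = B - {n}" (is ?up)
      and low: "{x \<in> B - {n} \<union> ?C \<rho>. x \<le> Max (?C \<rho>)} = ?C \<rho>" (is ?low)
      and mx: "Max (?C \<rho>) \<in> ?C \<rho>"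
      if "(B, \<rho>) \<in> ?R" "Suc n \<notin> B" for B \<rho>
    proof -
      note D = rooted_ncD[OF that(1)]
      have fin: "finite (?C \<rho>)" using C(1)[OF that] D(7) by blast
      show mx: "Max (?C \<rho>) \<in> ?C \<rho>" using fin C(2)[OF that] by (intro Max_in) auto
      have "Max (?C \<rho>) < b" if "b \<in> B - {n}" for b
        using rooted_nc_below[OF \<open>(B, \<rho>) \<in> ?R\<close> C[OF \<open>(B, \<rho>) \<in> ?R\<close> \<open>Suc n \<notin> B\<close>] _ _ mx] that by auto
      then show ?up ?low using Max_ge[OF fin] by force+
    qed
    show ?thesis
    proof (rule sum.reindex_bij_witness[where
          j = "\<lambda>(B, \<rho>). ((B - {n} \<union> ?C \<rho>, \<rho> - {?C \<rho>}), Max (?C \<rho>))" and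
          i = "\<lambda>((B, \<rho>), t). (insert n {x\<in>B. x > t}, insert {x\<in>B. x \<le> t} \<rho>)"], goal_cases)
      case (1 p)
      then obtain B \<rho> where p: "p = (B, \<rho>)" "(B, \<rho>) \<in> ?R" "Suc n \<notin> B" by (cases p) auto
      show ?case
        unfolding p(1) prod.case up[OF p(2,3)] low[OF p(2,3)]
        using C[OF p(2,3)] rooted_ncD(1)[OF p(2)] by auto
    next
      case (2 p)
      then obtain B \<rho> where p: "p = (B, \<rho>)" "(B, \<rho>) \<in> ?R" "Suc n \<notin> B" by (cases p) auto
      show ?case
        unfolding p(1) prod.case using rooted_nc_merge[OF p(2) C[OF p(2,3)]] mx[OF p(2,3)] by auto
    next
      case (3 q)
      then obtain B \<rho> t where q: "q = ((B, \<rho>), t)" "(B, \<rho>) \<in> ?R'" "t \<in> B" by (cases q) auto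
      have "Max {x\<in>B. x \<le> t} = t" using q(3) rooted_ncD(3)[OF q(2)] by (intro Max_eqI) auto
      then show ?case
        unfolding q(1) prod.case Ceq[OF q(2,3)] using notin[OF q(2,3)] n_notin[OF q(2)] by auto
    next
      case (4 q)
      then obtain B \<rho> t where q: "q = ((B, \<rho>), t)" "(B, \<rho>) \<in> ?R'" "t \<in> B" by (cases q) auto
      have "Suc n \<le> t" using rooted_ncD(2)[OF q(2)] q(3) by auto
      then show ?case
        unfolding q(1) prod.case using rooted_nc_cut[OF q(2,3)] by auto
    next
      case (5 p)
      then obtain B \<rho> where p: "p = (B, \<rho>)" "(B, \<rho>) \<in> ?R" "Suc n \<notin> B" by (cases p) auto
      have "(\<Prod>C\<in>\<rho>. \<phi> (card C - 1)) = \<phi> (card (?C \<rho>) - 1) * (\<Prod>C\<in>\<rho> - {?C \<rho>}. \<phi> (card C - 1))"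
        using C(1)[OF p(2,3)] rooted_ncD(4)[OF p(2)] by (rule prod.remove[rotated])
      moreover have "card (B - {n}) = card B - 1"
        using rooted_ncD(1,3)[OF p(2)] by simp
      ultimately show ?case
        unfolding p(1) prod.case up[OF p(2,3)] low[OF p(2,3)] nc_weight_def by simp
    qed
  qed
  also have "\<dots> = (\<Sum>(B, \<rho>)\<in>?R'. \<Sum>t\<in>B.
      \<gamma> (card {x\<in>B. x > t}) * (\<phi> (card {x\<in>B. x \<le> t} - 1) * (\<Prod>C\<in>\<rho>. \<phi> (card C - 1))))"
    by (subst sum.Sigma[symmetric]) (auto simp: finite_rooted_nc split_def dest: rooted_ncD(3))
  also have "(\<Sum>(B, \<rho>)\<in>?R'. \<gamma> (card B) * (\<Prod>C\<in>\<rho>. \<phi> (card C - 1))) + \<dots> =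
      (\<Sum>p\<in>?R'. nc_weight \<phi> (cumulant_step \<phi> \<gamma>) p)"
    unfolding sum.distrib[symmetric]
  proof (rule sum.cong)
    fix p assume "p \<in> ?R'"
    then obtain B \<rho> where p: "p = (B, \<rho>)" "(B, \<rho>) \<in> ?R'" by (cases p) auto
    note D = rooted_ncD[OF p(2)]
    obtain s where s: "card B = Suc s" using D(1,3) by (cases "card B") auto
    have "(\<Sum>t\<in>B. \<gamma> (card {x\<in>B. x > t}) * (\<phi> (card {x\<in>B. x \<le> t} - 1) * (\<Prod>C\<in>\<rho>. \<phi> (card C - 1)))) =
        (\<Sum>t\<in>B. \<phi> (card {x\<in>B. x \<le> t} - 1) * \<gamma> (card {x\<in>B. x > t})) * (\<Prod>C\<in>\<rho>. \<phi> (card C - 1))"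
      unfolding sum_distrib_right by (intro sum.cong refl) (simp add: mult_ac)
    also have "(\<Sum>t\<in>B. \<phi> (card {x\<in>B. x \<le> t} - 1) * \<gamma> (card {x\<in>B. x > t})) =
        (\<Sum>a\<le>s. \<phi> a * \<gamma> (s - a))"
      by (rule sum_card_cut[OF D(3) s, of "\<lambda>a b. \<phi> a * \<gamma> b"])
    finally show "(case p of (B, \<rho>) \<Rightarrow> \<gamma> (card B) * (\<Prod>C\<in>\<rho>. \<phi> (card C - 1))) +
        (case p of (B, \<rho>) \<Rightarrow> \<Sum>t\<in>B.
          \<gamma> (card {x\<in>B. x > t}) * (\<phi> (card {x\<in>B. x \<le> t} - 1) * (\<Prod>C\<in>\<rho>. \<phi> (card C - 1)))) =
        nc_weight \<phi> (cumulant_step \<phi> \<gamma>) p"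
      by (simp add: p(1) nc_weight_def cumulant_step_def s algebra_simps)
  qed simp
  finally show ?thesis .
qed

lemma rooted_nc_singleton: "rooted_nc k k = {({k}, {})}"
proof -
  have "B = {k} \<and> \<rho> = {}" if "(B, \<rho>) \<in> rooted_nc k k" for B \<rho>
  proof -
    note D = rooted_ncD[OF that]
    have B: "B = {k}" using D(1,2) by auto
    then have "\<Union>\<rho> = {}" using D(6) by simp
    then have "\<rho> \<subseteq> {{}}" by blast
    then have "\<rho> = {}" using D(5) by blast
    then show ?thesis using B by blast
  qed
  then have "p = ({k}, {})" if "p \<in> rooted_nc k k" for p using that by (cases p) blast
  moreover have "({k}, {}) \<in> rooted_nc k k" by (rule rooted_ncI) simp_all
  ultimately show ?thesis by blast
qed

text \<open>In j steps the root moves up from k - j to k, where the only partition left has weight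
  \<open>\<gamma> 0\<close>. Every step changes the weight of the root block, so the induction
  generalizes \<open>\<gamma>\<close>.\<close>

lemma sum_rooted_nc:
  "j \<le> k \<Longrightarrow> (\<Sum>p\<in>rooted_nc (k - j) k. nc_weight \<phi> \<gamma> p) = (cumulant_step \<phi> ^^ j) \<gamma> 0"
proof (induction j arbitrary: \<gamma>)
  case 0
  show ?case by (simp add: rooted_nc_singleton nc_weight_def)
next
  case (Suc j)
  have "k - Suc j < k" "Suc (k - Suc j) = k - j" using Suc.prems by auto
  then show ?case
    using sum_rooted_nc_step[of "k - Suc j" k \<phi> \<gamma>] Suc by (simp add: funpow_swap1)
qed

section \<open>Noncrossing partitions with the block of 1 split off\<close>

lemma noncrossing_partitions_iff:
  "\<pi> \<in> noncrossing_partitions k \<longleftrightarrow>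
    partition_on {1..k} \<pi> \<and> (\<forall>A\<in>\<pi>. \<forall>B\<in>\<pi>. A \<noteq> B \<longrightarrow> \<not> crossing A B)"
  unfolding noncrossing_partitions_def mem_Collect_eq crossing_def[symmetric]
  by (simp only: bex_simps not_ex) blast

lemma rooted_nc_imp_noncrossing:
  assumes "(B, \<rho>) \<in> rooted_nc 1 k"
  shows "insert B \<rho> \<in> noncrossing_partitions k"
proof -
  note D = rooted_ncD[OF assms]
  have BC: "B \<inter> C = {}" if "C \<in> \<rho>" for C using D(6) that by blast
  have "partition_on {1..k} (insert B \<rho>)"
  proof (rule partition_onI)
    show "\<Union>(insert B \<rho>) = {1..k}" using D(2,6) by auto
    show "disjnt C E" if "C \<in> insert B \<rho>" "E \<in> insert B \<rho>" "C \<noteq> E" for C E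
      using that BC D(8) unfolding disjnt_def by (metis Int_commute insertE)
  qed (use D(1,5) in auto)
  moreover have "\<not> crossing C E" if "C \<in> insert B \<rho>" "E \<in> insert B \<rho>" "C \<noteq> E" for C E
    using that D(9,10,11) by (metis insertE)
  ultimately show ?thesis by (simp add: noncrossing_partitions_iff)
qed

text \<open>Ordering by minima makes \<open>block \<pi> 1\<close> the block of 1, hence the root
  block; the order of the others does not affect the product.\<close>

lemma sum_noncrossing_partitions:
  assumes "k \<ge> 1"
  shows "(\<Sum>\<pi>\<in>noncrossing_partitions k. \<gamma> (card (block \<pi> 1) - 1) *
      (\<Prod>l = 2..card \<pi>. \<phi> (card (block \<pi> l) - 1))) =
    (\<Sum>p\<in>rooted_nc 1 k. nc_weight \<phi> \<gamma> p)"
proof -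
  let ?L = "sorted_key_list_of_set Min :: nat set set \<Rightarrow> nat set list"
  have props: "1 \<in> block \<pi> 1" "block \<pi> 1 \<in> \<pi>"
      "(\<Prod>l = 2..card \<pi>. \<phi> (card (block \<pi> l) - 1)) = (\<Prod>C\<in>\<pi> - {block \<pi> 1}. \<phi> (card C - 1))"
    if \<pi>: "\<pi> \<in> noncrossing_partitions k" for \<pi>
  proof -
    have P: "partition_on {1..k} \<pi>" using \<pi> by (simp add: noncrossing_partitions_def)
    note ord = blocks_ordered[OF \<pi>]
    have "1 \<in> \<Union>\<pi>" using partition_onD1[OF P] assms by auto
    then obtain B where B: "B \<in> \<pi>" "1 \<in> B" by blast
    obtain A xs where L: "?L \<pi> = A # xs" using ord(2) B by (cases "?L \<pi>") auto
    have A: "block \<pi> 1 = A" by (simp add: block_def L)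
    have A\<pi>: "A \<in> \<pi>" using ord(2) L by auto
    have fin: "finite C" if "C \<in> \<pi>" for C
      using that partition_onD1[OF P] by (metis Union_upper finite_atLeastAtMost finite_subset)
    have "A \<noteq> {}" using A\<pi> partition_onD3[OF P] by blast
    then have MA: "Min A \<in> A" using fin[OF A\<pi>] by simp
    then have "1 \<le> Min A" using A\<pi> partition_onD1[OF P] by auto
    moreover have "Min A \<le> Min B"
    proof -
      have "B \<in> set (A # xs)" using B(1) ord(2) L by simp
      then show ?thesis using ord(3) L by auto
    qed
    moreover have "Min B \<le> 1" using B fin by simp
    ultimately show "1 \<in> block \<pi> 1" using MA A by (metis dual_order.trans le_antisym)
    show "block \<pi> 1 \<in> \<pi>" using A A\<pi> by simp
    have d: "distinct (A # xs)" and s: "insert A (set xs) = \<pi>" using ord(1,2) L by auto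
    have c: "card \<pi> = Suc (length xs)" using d s distinct_card[of "A # xs"] by auto
    \<comment> \<open>\<open>block\<close> counts from 1 and the head \<open>A\<close> is removed,
      so block l is entry l - 2 of \<open>xs\<close>.\<close>
    have "(\<Prod>l = 2..card \<pi>. \<phi> (card (block \<pi> l) - 1)) = (\<Prod>l<length xs. \<phi> (card (xs ! l) - 1))"
      by (rule prod.reindex_bij_witness[where i = "\<lambda>l. l + 2" and j = "\<lambda>l. l - 2"])
         (auto simp: c block_def L nth_Cons' numeral_2_eq_2)
    also have "\<dots> = (\<Prod>C\<in>set xs. \<phi> (card C - 1))"
      using d by (intro prod.reindex_bij_betw bij_betw_nth) auto
    also have "set xs = \<pi> - {A}" using d s by auto
    finally show "(\<Prod>l = 2..card \<pi>. \<phi> (card (block \<pi> l) - 1)) =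
        (\<Prod>C\<in>\<pi> - {block \<pi> 1}. \<phi> (card C - 1))" using A by simp
  qed
  show ?thesis
  proof (rule sum.reindex_bij_witness[where j = "\<lambda>\<pi>. (block \<pi> 1, \<pi> - {block \<pi> 1})"
        and i = "\<lambda>(B, \<rho>). insert B \<rho>"], goal_cases)
    case (1 \<pi>)
    then show ?case using props by auto
  next
    case (2 \<pi>)
    note p = props[OF 2]
    have P: "partition_on {1..k} \<pi>"
      and nc: "\<And>A B. A \<in> \<pi> \<Longrightarrow> B \<in> \<pi> \<Longrightarrow> A \<noteq> B \<Longrightarrow> \<not> crossing A B"
      using 2 by (auto simp: noncrossing_partitions_iff)
    have disj: "A \<inter> B = {}" if "A \<in> \<pi>" "B \<in> \<pi>" "A \<noteq> B" for A B
      using partition_onD2[OF P] that by (auto simp: disjoint_def)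
    show ?case
    proof (rule rooted_ncI)
      show "\<Union>(\<pi> - {block \<pi> 1}) = {1..k} - block \<pi> 1"
      proof -
        have "\<Union>(\<pi> - {block \<pi> 1}) = \<Union>\<pi> - block \<pi> 1" using disj[OF p(2)] by blast
        then show ?thesis using partition_onD1[OF P] by simp
      qed
      show "block \<pi> 1 \<subseteq> {1..k}" using partition_onD1[OF P] p(2) by blast
      show "{} \<notin> \<pi> - {block \<pi> 1}" using partition_onD3[OF P] by blast
      fix C assume C: "C \<in> \<pi> - {block \<pi> 1}"
      show "\<not> crossing (block \<pi> 1) C" using nc[OF p(2), of C] C by blast
      show "\<not> crossing C (block \<pi> 1)" using nc[OF _ p(2), of C] C by blast
      fix D assume "D \<in> \<pi> - {block \<pi> 1}" "C \<noteq> D"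
      then show "C \<inter> D = {}" "\<not> crossing C D" using disj[of C D] nc[of C D] C by blast+
    qed (rule p(1))
  next
    case (3 q)
    then obtain B \<rho> where q: "q = (B, \<rho>)" "(B, \<rho>) \<in> rooted_nc 1 k" by (cases q) auto
    note D = rooted_ncD[OF q(2)]
    note p = props[OF rooted_nc_imp_noncrossing[OF q(2)]]
    have notin: "C \<notin> \<rho>" if "1 \<in> C" for C using D(1,6) that by blast
    have "block (insert B \<rho>) 1 = B" using p(1,2) notin by (metis insertE)
    then show ?case using q(1) notin[OF D(1)] by auto
  next
    case (4 q)
    then show ?case by (cases q) (use rooted_nc_imp_noncrossing in simp)
  next
    case (5 \<pi>)
    show ?case by (simp only: nc_weight_def prod.case props(3)[OF 5])
  qed
qed


section \<open>The limit of the constant terms\<close>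

theorem theorem2p9:
  fixes \<theta> :: complex
    and \<theta>s :: "nat \<Rightarrow> complex"
    and i k :: nat
    and f :: "nat \<Rightarrow> nat \<Rightarrow> series"
    and g :: "nat \<Rightarrow> series"
    and f_lim g_lim :: "nat \<Rightarrow> nat multiset \<Rightarrow> complex"
  assumes "\<theta>s \<longlonglongrightarrow> \<theta>"
    and "i \<ge> 1" and "k \<ge> 1"
    and "\<And>j. 1 \<le> j \<Longrightarrow> j \<le> k - 1 \<Longrightarrow> symmetric_outside i (f j)"
    and "symmetric_outside i g"
    and "\<And>j. 1 \<le> j \<Longrightarrow> j \<le> k - 1 \<Longrightarrow> has_limiting_sequence i (f j) f_lim"
    and "has_limiting_sequence i g g_lim"
  shows "(\<lambda>N. const_term (fold (\<lambda>j. Q_op (\<theta>s N) N i (f j N)) [1..<k] (g N)))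
    \<longlonglongrightarrow> (\<Sum>\<pi>\<in>noncrossing_partitions k.
      free_cumulant \<theta> g_lim (card (block \<pi> 1)) *
      (\<Prod>l = 2..card \<pi>. free_cumulant \<theta> f_lim (card (block \<pi> l))))"
proof -
  \<comment> \<open>Index n belongs to the cumulant of order n + 1, which is \<theta>^n times the
    coefficient of t^n in the specialized limit.\<close>
  define \<phi> where "\<phi> n = free_cumulant \<theta> f_lim (Suc n)" for n
  define \<gamma> where "\<gamma> n = free_cumulant \<theta> g_lim (Suc n)" for n
  let ?F = "\<lambda>j N. fold (\<lambda>j. Q_op (\<theta>s N) N i (f j N)) [1..<Suc j] (g N)"
  \<comment> \<open>Invariant after j operators. Scaling the coefficient of t^n by \<theta>^n turns
    \<theta> S into the plain shift S of \<open>cumulant_step\<close>; nothing is divided by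
    \<theta>, so \<theta> = 0 is covered.\<close>
  have "\<exists>h. limit_outside i (?F j) h \<and>
      (\<forall>n. \<theta> ^ n * virtual_eval h n = (cumulant_step \<phi> ^^ j) \<gamma> n)" if "j \<le> k - 1" for j
    using that
  proof (induction j)
    case 0
    show ?case
      using limit_outside_partition_fun[OF assms(2,5,7)]
      by (intro exI[of _ "partition_fun g_lim"]) (simp add: \<gamma>_def free_cumulant_eq_virtual_eval)
  next
    case (Suc j)
    then obtain h where h: "limit_outside i (?F j) h"
      and ev: "\<And>n. \<theta> ^ n * virtual_eval h n = (cumulant_step \<phi> ^^ j) \<gamma> n" by auto
    let ?hf = "partition_fun f_lim"
    have lf: "limit_outside i (f (Suc j)) ?hf"
      using Suc.prems by (intro limit_outside_partition_fun assms) auto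
    have "limit_outside i (?F (Suc j)) (limit_op \<theta> ?hf h)"
      using limit_outside_Q_op[OF assms(1,2) lf h] by simp
    moreover have "\<theta> ^ n * virtual_eval (limit_op \<theta> ?hf h) n = (cumulant_step \<phi> ^^ Suc j) \<gamma> n" for n
    proof -
      have "\<theta> ^ n * virtual_eval (limit_op \<theta> ?hf h) n = \<theta> ^ Suc n * virtual_eval h (Suc n) +
          (\<Sum>a\<le>n. \<theta> ^ n * (virtual_eval ?hf a * virtual_eval h (n - a)))"
        by (simp add: virtual_eval_limit_op zero_insensitive_partition_fun
            limit_outside_zero_insensitive[OF assms(2) h] distrib_left sum_distrib_left mult_ac)
      also have "(\<Sum>a\<le>n. \<theta> ^ n * (virtual_eval ?hf a * virtual_eval h (n - a))) =
          (\<Sum>a\<le>n. \<phi> a * (cumulant_step \<phi> ^^ j) \<gamma> (n - a))"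
      proof (rule sum.cong)
        fix a assume "a \<in> {..n}"
        \<comment> \<open>The scaling is compatible with products: each factor receives the power of
          \<theta> matching its own degree.\<close>
        then have "\<theta> ^ n = \<theta> ^ a * \<theta> ^ (n - a)" by (simp flip: power_add)
        then show "\<theta> ^ n * (virtual_eval ?hf a * virtual_eval h (n - a)) =
            \<phi> a * (cumulant_step \<phi> ^^ j) \<gamma> (n - a)"
          by (simp add: \<phi>_def free_cumulant_eq_virtual_eval mult_ac flip: ev)
      qed simp
      finally show ?thesis unfolding ev by (simp add: cumulant_step_def)
    qed
    ultimately show ?case by blast
  qed
  from this[of "k - 1"] obtain h where h: "limit_outside i (?F (k - 1)) h"
    and ev: "\<And>n. \<theta> ^ n * virtual_eval h n = (cumulant_step \<phi> ^^ (k - 1)) \<gamma> n" by auto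
  \<comment> \<open>\<open>list_monomial i [0]\<close> is the zero exponent vector, so this is the
    constant term; the invariant is then read at n = 0.\<close>
  have "(\<lambda>N. ?F (k - 1) N (list_monomial i [0])) \<longlonglongrightarrow> h 0 []"
    using h unfolding limit_outside_def by blast
  moreover have "h 0 [] = (cumulant_step \<phi> ^^ (k - 1)) \<gamma> 0"
    using ev[of 0] by (simp add: virtual_eval_def)
  moreover have "(cumulant_step \<phi> ^^ (k - 1)) \<gamma> 0 = (\<Sum>p\<in>rooted_nc 1 k. nc_weight \<phi> \<gamma> p)"
    using sum_rooted_nc[of "k - 1" k \<phi> \<gamma>] assms(3) by simp
  moreover have "(\<Sum>p\<in>rooted_nc 1 k. nc_weight \<phi> \<gamma> p) = (\<Sum>\<pi>\<in>noncrossing_partitions k.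
      \<gamma> (card (block \<pi> 1) - 1) * (\<Prod>l = 2..card \<pi>. \<phi> (card (block \<pi> l) - 1)))"
    by (rule sum_noncrossing_partitions[OF assms(3), symmetric])
  \<comment> \<open>\<open>free_cumulant\<close> depends on its order only through order minus 1, so
    passing from \<open>card\<close> to \<open>Suc (card - 1)\<close> keeps its value.\<close>
  moreover have "\<dots> = (\<Sum>\<pi>\<in>noncrossing_partitions k.
      free_cumulant \<theta> g_lim (card (block \<pi> 1)) *
      (\<Prod>l = 2..card \<pi>. free_cumulant \<theta> f_lim (card (block \<pi> l))))"
    by (simp add: \<phi>_def \<gamma>_def free_cumulant_def)
  moreover have "Suc (k - 1) = k" using assms(3) by simp
  ultimately show ?thesis by (simp add: const_term_def)
qed

end
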